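(* Let $R=\mathbb{C}\langle x,y\rangle/(xy-yx-y^2)$, let $n\ge 1$, and let $\mathrm{mod}(R,n)=\{(X,Y)\in M_n(\mathbb{C})^2 : XY-YX=Y^2\}$. Among the irreducible components of $\mathrm{mod}(R,n)$, the component $K_{(n)}=\overline{\mathcal{U}_{(n)}}$ (Zariski closure), and only this one, contains an open dense subset consisting of indecomposable modules.
   Context: $\mathcal{U}_{(n)}$ is the set of pairs $(X,Y)\in\mathrm{mod}(R,n)$ for which $Y$ is nilpotent with a single Jordan block of size $n$. A point $(X,Y)\in\mathrm{mod}(R,n)$ is identified with the $R$-module structure on $\mathbb{C}^n$ in which $x$ acts by $X$ and $y$ acts by $Y$. *)

theory Defs
  imports
    "Jordan_Normal_Form.Jordan_Normal_Form"
    "HOL-Analysis.Abstract_Topology"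
begin

inductive polynomial_fun :: "nat \<Rightarrow> (complex mat \<times> complex mat \<Rightarrow> complex) \<Rightarrow> bool" for n where
  const: "polynomial_fun n (\<lambda>p. c)"
| fst_entry: "i < n \<Longrightarrow> j < n \<Longrightarrow> polynomial_fun n (\<lambda>p. fst p $$ (i, j))"
| snd_entry: "i < n \<Longrightarrow> j < n \<Longrightarrow> polynomial_fun n (\<lambda>p. snd p $$ (i, j))"
| add: "polynomial_fun n f \<Longrightarrow> polynomial_fun n g \<Longrightarrow> polynomial_fun n (\<lambda>p. f p + g p)"
| mult: "polynomial_fun n f \<Longrightarrow> polynomial_fun n g \<Longrightarrow> polynomial_fun n (\<lambda>p. f p * g p)"

definition mat_pairs :: "nat \<Rightarrow> (complex mat \<times> complex mat) set" where
  "mat_pairs n = carrier_mat n n \<times> carrier_mat n n"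

definition zero_locus ::
    "nat \<Rightarrow> (complex mat \<times> complex mat \<Rightarrow> complex) set \<Rightarrow> (complex mat \<times> complex mat) set" where
  "zero_locus n F = {p \<in> mat_pairs n. \<forall>f\<in>F. f p = 0}"

definition zariski :: "nat \<Rightarrow> (complex mat \<times> complex mat) topology" where
  "zariski n = topology (\<lambda>U. \<exists>F. (\<forall>f\<in>F. polynomial_fun n f) \<and> U = mat_pairs n - zero_locus n F)"

lemma istopology_zariski:
  "istopology (\<lambda>U. \<exists>F. (\<forall>f\<in>F. polynomial_fun n f) \<and> U = mat_pairs n - zero_locus n F)"
    (is "istopology ?P")
  unfolding istopology_def
proof (intro conjI allI impI)
  fix S T assume "?P S" "?P T"
  then obtain F G where F: "\<forall>f\<in>F. polynomial_fun n f" "S = mat_pairs n - zero_locus n F"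
    and G: "\<forall>g\<in>G. polynomial_fun n g" "T = mat_pairs n - zero_locus n G"
    by blast
  define H where "H = {(\<lambda>p. f p * g p) | f g. f \<in> F \<and> g \<in> G}"
  have "\<forall>h\<in>H. polynomial_fun n h"
    using F(1) G(1) by (auto simp: H_def intro: polynomial_fun.mult)
  moreover have "S \<inter> T = mat_pairs n - zero_locus n H"
  proof (intro Set.set_eqI iffI)
    fix p assume "p \<in> S \<inter> T"
    then obtain f g where fg: "p \<in> mat_pairs n" "f \<in> F" "g \<in> G" "f p \<noteq> 0" "g p \<noteq> 0"
      unfolding F(2) G(2) zero_locus_def by auto
    then have "(\<lambda>p. f p * g p) \<in> H" "f p * g p \<noteq> 0"
      by (auto simp: H_def)
    with fg(1) show "p \<in> mat_pairs n - zero_locus n H"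
      unfolding zero_locus_def by fastforce
  next
    fix p assume "p \<in> mat_pairs n - zero_locus n H"
    then show "p \<in> S \<inter> T"
      unfolding F(2) G(2) zero_locus_def H_def by auto
  qed
  ultimately show "?P (S \<inter> T)" by blast
next
  fix \<K> assume *: "\<forall>K\<in>\<K>. ?P K"
  from bchoice[OF *] obtain F where F: "\<forall>K\<in>\<K>. \<forall>f\<in>F K. polynomial_fun n f"
      "\<forall>K\<in>\<K>. K = mat_pairs n - zero_locus n (F K)"
    by blast
  have "\<Union>\<K> = (\<Union>K\<in>\<K>. mat_pairs n - zero_locus n (F K))"
    using F(2) by (metis (no_types, lifting) SUP_cong image_ident)
  also have "\<dots> = mat_pairs n - zero_locus n (\<Union>K\<in>\<K>. F K)"
    unfolding zero_locus_def by blast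
  finally have "\<Union>\<K> = mat_pairs n - zero_locus n (\<Union>K\<in>\<K>. F K)" .
  moreover have "\<forall>f\<in>(\<Union>K\<in>\<K>. F K). polynomial_fun n f"
    using F(1) by simp
  ultimately show "?P (\<Union>\<K>)" by (intro exI conjI)
qed

lemma openin_zariski:
  "openin (zariski n) U \<longleftrightarrow>
     (\<exists>F. (\<forall>f\<in>F. polynomial_fun n f) \<and> U = mat_pairs n - zero_locus n F)"
  unfolding zariski_def topology_inverse'[OF istopology_zariski] ..

lemma topspace_zariski: "topspace (zariski n) = mat_pairs n"
proof
  show "topspace (zariski n) \<subseteq> mat_pairs n"
    unfolding topspace_def openin_zariski by blast
  have "openin (zariski n) (mat_pairs n)"
    unfolding openin_zariski zero_locus_def
    by (rule exI[of _ "{\<lambda>p. 1}"]) (auto intro: polynomial_fun.const)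
  then show "mat_pairs n \<subseteq> topspace (zariski n)"
    by (rule openin_subset)
qed

lemma closedin_zariski:
  "closedin (zariski n) C \<longleftrightarrow> (\<exists>F. (\<forall>f\<in>F. polynomial_fun n f) \<and> C = zero_locus n F)"
proof -
  have sub: "zero_locus n F \<subseteq> mat_pairs n" for F
    unfolding zero_locus_def by blast
  have "C \<subseteq> mat_pairs n \<and> mat_pairs n - C = mat_pairs n - zero_locus n F \<longleftrightarrow>
      C = zero_locus n F" for F
    using sub[of F] by blast
  then show ?thesis
    unfolding closedin_def openin_zariski topspace_zariski by metis
qed

definition irreducible_in :: "'a topology \<Rightarrow> 'a set \<Rightarrow> bool" where
  "irreducible_in T S \<longleftrightarrow> S \<subseteq> topspace T \<and> S \<noteq> {} \<and>
     (\<forall>A B. closedin T A \<longrightarrow> closedin T B \<longrightarrow> S \<subseteq> A \<union> B \<longrightarrow> S \<subseteq> A \<or> S \<subseteq> B)"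

definition irreducible_components :: "'a topology \<Rightarrow> 'a set set" where
  "irreducible_components T =
     {S. irreducible_in T S \<and> (\<forall>S'. irreducible_in T S' \<longrightarrow> S \<subseteq> S' \<longrightarrow> S' = S)}"

definition mod_R :: "nat \<Rightarrow> (complex mat \<times> complex mat) set" where
  "mod_R n = {(X, Y). X \<in> carrier_mat n n \<and> Y \<in> carrier_mat n n \<and> X * Y - Y * X = Y * Y}"

definition mod_R_topology :: "nat \<Rightarrow> (complex mat \<times> complex mat) topology" where
  "mod_R_topology n = subtopology (zariski n) (mod_R n)"

definition U_full :: "nat \<Rightarrow> (complex mat \<times> complex mat) set" where
  "U_full n = {(X, Y) \<in> mod_R n. jordan_nf Y [(n, 0)]}"

definition K_full :: "nat \<Rightarrow> (complex mat \<times> complex mat) set" where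
  "K_full n = zariski n closure_of U_full n"

text \<open>A point \<open>(X, Y)\<close> of \<open>mod_R n\<close> is the algebra homomorphism from
  \<open>R = \<complex>\<langle>x, y\<rangle> / (xy - yx - y\<^sup>2)\<close> to the matrix algebra with \<open>x \<mapsto> X\<close> and \<open>y \<mapsto> Y\<close>.
  The following set is the image of this homomorphism, that is, the set of the operators by which
  the elements of \<open>R\<close> act on \<open>\<complex>\<^sup>n\<close>.\<close>

inductive_set R_operators :: "nat \<Rightarrow> complex mat \<times> complex mat \<Rightarrow> complex mat set"
  for n p where
  scalar: "c \<cdot>\<^sub>m 1\<^sub>m n \<in> R_operators n p"
| x: "fst p \<in> R_operators n p"
| y: "snd p \<in> R_operators n p"
| add: "A \<in> R_operators n p \<Longrightarrow> B \<in> R_operators n p \<Longrightarrow> A + B \<in> R_operators n p"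
| mult: "A \<in> R_operators n p \<Longrightarrow> B \<in> R_operators n p \<Longrightarrow> A * B \<in> R_operators n p"

definition R_submodule :: "nat \<Rightarrow> complex mat \<times> complex mat \<Rightarrow> complex vec set \<Rightarrow> bool" where
  "R_submodule n p W \<longleftrightarrow> W \<subseteq> carrier_vec n \<and> 0\<^sub>v n \<in> W \<and>
     (\<forall>v\<in>W. \<forall>w\<in>W. v + w \<in> W) \<and> (\<forall>A\<in>R_operators n p. \<forall>w\<in>W. A *\<^sub>v w \<in> W)"

definition indecomposable :: "nat \<Rightarrow> complex mat \<times> complex mat \<Rightarrow> bool" where
  "indecomposable n p \<longleftrightarrow> carrier_vec n \<noteq> {0\<^sub>v n :: complex vec} \<and>
     \<not> (\<exists>V W. R_submodule n p V \<and> R_submodule n p W \<and> V \<noteq> {0\<^sub>v n} \<and> W \<noteq> {0\<^sub>v n} \<and>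
          V \<inter> W = {0\<^sub>v n} \<and> {v + w | v w. v \<in> V \<and> w \<in> W} = carrier_vec n)"

text \<open>Open and dense refer to the topology of \<open>K\<close> induced by the Zariski topology.\<close>

definition has_open_dense_indecomposables :: "nat \<Rightarrow> (complex mat \<times> complex mat) set \<Rightarrow> bool" where
  "has_open_dense_indecomposables n K \<longleftrightarrow>
     (\<exists>U. openin (subtopology (zariski n) K) U \<and> subtopology (zariski n) K closure_of U = K \<and>
          (\<forall>p\<in>U. indecomposable n p))"

end

theory Submission
  imports Defs "Jordan_Normal_Form.Jordan_Normal_Form_Existence" "Jordan_Normal_Form.Spectral_Radius"
begin

text \<open>The relation gives \<open>X Y\<^sup>k - Y\<^sup>k X = k Y\<^sup>k\<^sup>+\<^sup>1\<close>. Hence a linear relation among the powers of \<open>Y\<close> can be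
  shortened by taking the commutator with \<open>X\<close>, until it says that a power of \<open>Y\<close> vanishes
  (\<open>mod_R_nilpotent\<close>). So \<open>Y\<close> is conjugate to one of finitely many Jordan matrices \<open>J\<close> with
  eigenvalue 0, and \<open>mod_R n\<close> is covered by the finitely many families of pairs that arise by
  conjugation and scaling from \<open>(X, J)\<close> with \<open>X J - J X = J\<^sup>2\<close> (\<open>mod_R_cover\<close>). Such a family is
  irreducible: the condition on \<open>X\<close> is affine, so any two of its points lie on a polynomial curve
  that leaves the family at finitely many parameters only (\<open>irreducible_conj_family\<close>). Every
  irreducible component is therefore the closure of one of these families.

  The family of the single Jordan block of size \<open>n\<close> is \<open>U_full n\<close>. It is the subset of
  \<open>mod_R n\<close> where \<open>Y\<^sup>n\<^sup>-\<^sup>1\<close> does not vanish (\<open>U_full_eq_pow_nonzero\<close>), so it is open, and its closure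
  is a component. Its points are indecomposable because every nonzero submodule contains the
  kernel of \<open>Y\<close>, which is a line (\<open>U_full_indecomposable\<close>).

  Conversely, let \<open>(X, Y)\<close> be indecomposable and \<open>l\<close> an eigenvalue of \<open>X\<close>. The decomposition of the
  space into the generalised eigenspace of \<open>l\<close> and its Fitting complement is stable under \<open>Y\<close>, since \<open>Y\<close>
  is annihilated by a power of the commutator with \<open>X\<close>. So \<open>l\<close> is the only eigenvalue
  (\<open>indecomposable_nilpotent_shift\<close>). That \<open>X\<close> has a single eigenvalue is a closed condition,
  namely that the traceless part of \<open>X\<close> is nilpotent. A component in which indecomposable modules
  are dense thus consists of points with a single eigenvalue. But if \<open>J\<close> has more than one block,
  its family contains a point whose first matrix has the eigenvalues 0 and 1
  (\<open>two_eigenvalues_of_nonfull_type\<close>). Only the closure of \<open>U_full n\<close> is left.\<close>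

section \<open>Irreducible sets and components\<close>

lemma irreducible_in_subtopology:
  assumes "S \<subseteq> M"
  shows "irreducible_in (subtopology T M) S \<longleftrightarrow> irreducible_in T S"
proof
  assume irr: "irreducible_in (subtopology T M) S"
  show "irreducible_in T S"
    unfolding irreducible_in_def
  proof (intro conjI allI impI)
    show "S \<subseteq> topspace T" "S \<noteq> {}"
      using irr by (auto simp: irreducible_in_def)
    fix A B assume "closedin T A" "closedin T B" "S \<subseteq> A \<union> B"
    then have "closedin (subtopology T M) (A \<inter> M)" "closedin (subtopology T M) (B \<inter> M)"
        "S \<subseteq> (A \<inter> M) \<union> (B \<inter> M)"
      using assms by (auto simp: closedin_subtopology)
    then have "S \<subseteq> A \<inter> M \<or> S \<subseteq> B \<inter> M"
      using irr unfolding irreducible_in_def by blast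
    then show "S \<subseteq> A \<or> S \<subseteq> B" by blast
  qed
next
  assume irr: "irreducible_in T S"
  show "irreducible_in (subtopology T M) S"
    unfolding irreducible_in_def
  proof (intro conjI allI impI)
    show "S \<subseteq> topspace (subtopology T M)" "S \<noteq> {}"
      using irr assms by (auto simp: irreducible_in_def)
    fix A B
    assume "closedin (subtopology T M) A" "closedin (subtopology T M) B" and S: "S \<subseteq> A \<union> B"
    then obtain A' B' where AB: "closedin T A'" "closedin T B'" "A = A' \<inter> M" "B = B' \<inter> M"
      by (auto simp: closedin_subtopology)
    with S have "S \<subseteq> A' \<union> B'" by blast
    then have "S \<subseteq> A' \<or> S \<subseteq> B'"
      using irr AB unfolding irreducible_in_def by blast
    then show "S \<subseteq> A \<or> S \<subseteq> B"
      using assms AB by blast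
  qed
qed

lemma irreducible_in_closure_of:
  assumes "irreducible_in T S"
  shows "irreducible_in T (T closure_of S)"
  unfolding irreducible_in_def
proof (intro conjI allI impI)
  have S: "S \<subseteq> topspace T" "S \<noteq> {}"
    using assms by (auto simp: irreducible_in_def)
  then have sub: "S \<subseteq> T closure_of S"
    by (simp add: closure_of_subset)
  show "T closure_of S \<subseteq> topspace T"
    by (rule closure_of_subset_topspace)
  show "T closure_of S \<noteq> {}"
    using sub S by blast
  fix A B assume AB: "closedin T A" "closedin T B" "T closure_of S \<subseteq> A \<union> B"
  with sub have "S \<subseteq> A \<or> S \<subseteq> B"
    using assms unfolding irreducible_in_def by (meson order_trans)
  then show "T closure_of S \<subseteq> A \<or> T closure_of S \<subseteq> B"
    using AB closure_of_minimal by metis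
qed

lemma irreducible_in_finite_Union:
  assumes "finite \<C>" "irreducible_in T S" "\<And>C. C \<in> \<C> \<Longrightarrow> closedin T C" "S \<subseteq> \<Union>\<C>"
  shows "\<exists>C\<in>\<C>. S \<subseteq> C"
proof -
  have "(\<forall>C\<in>\<D>. closedin T C) \<longrightarrow> S \<subseteq> \<Union>\<D> \<longrightarrow> (\<exists>C\<in>\<D>. S \<subseteq> C)" if "finite \<D>" for \<D>
    using that
  proof (rule finite_induct)
    show "(\<forall>C\<in>{}. closedin T C) \<longrightarrow> S \<subseteq> \<Union>{} \<longrightarrow> (\<exists>C\<in>{}. S \<subseteq> C)"
      using assms(2) by (simp add: irreducible_in_def)
  next
    fix C \<D>
    assume fin: "finite \<D>"
      and IH: "(\<forall>C\<in>\<D>. closedin T C) \<longrightarrow> S \<subseteq> \<Union>\<D> \<longrightarrow> (\<exists>C\<in>\<D>. S \<subseteq> C)"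
    show "(\<forall>C\<in>insert C \<D>. closedin T C) \<longrightarrow> S \<subseteq> \<Union>(insert C \<D>) \<longrightarrow>
        (\<exists>C\<in>insert C \<D>. S \<subseteq> C)"
    proof (intro impI)
      assume cl: "\<forall>C\<in>insert C \<D>. closedin T C" and S: "S \<subseteq> \<Union>(insert C \<D>)"
      have "closedin T (\<Union>\<D>)"
        by (rule closedin_Union[OF fin]) (use cl in simp)
      moreover have "closedin T C" "S \<subseteq> C \<union> \<Union>\<D>"
        using cl S by simp_all
      ultimately have "S \<subseteq> C \<or> S \<subseteq> \<Union>\<D>"
        using assms(2) by (metis irreducible_in_def)
      then show "\<exists>C\<in>insert C \<D>. S \<subseteq> C"
        using IH cl by (metis insert_iff)
    qed
  qed
  then show ?thesis
    using assms(1,3,4) by metis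
qed

text \<open>If finitely many irreducible sets cover a closed set \<open>M\<close>, then a component of \<open>M\<close> lies in the
  union of their closures, hence in one of them, and by maximality it is that closure.\<close>

lemma irreducible_component_eq_closure:
  assumes K: "K \<in> irreducible_components (subtopology T M)"
    and M: "closedin T M"
    and fin: "finite I"
    and irr: "\<And>i. i \<in> I \<Longrightarrow> S i \<noteq> {} \<Longrightarrow> irreducible_in T (S i)"
    and sub: "\<And>i. i \<in> I \<Longrightarrow> S i \<subseteq> M"
    and cover: "M \<subseteq> (\<Union>i\<in>I. S i)"
  shows "\<exists>i\<in>I. S i \<noteq> {} \<and> K = T closure_of (S i)"
proof -
  have KM: "K \<subseteq> M" and max: "\<And>S'. irreducible_in (subtopology T M) S' \<Longrightarrow> K \<subseteq> S' \<Longrightarrow> S' = K"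
    using K by (auto simp: irreducible_components_def irreducible_in_def)
  have Kirr: "irreducible_in T K"
    using K irreducible_in_subtopology[OF KM] by (auto simp: irreducible_components_def)
  have S: "S i \<subseteq> T closure_of S i" "T closure_of S i \<subseteq> M" if "i \<in> I" for i
    using sub[OF that] M closedin_subset[OF M] by (simp_all add: closure_of_subset closure_of_minimal)
  have "K \<subseteq> \<Union>((\<lambda>i. T closure_of S i) ` I)"
  proof
    fix x assume "x \<in> K"
    then obtain i where "i \<in> I" "x \<in> S i" using KM cover by auto
    then show "x \<in> \<Union>((\<lambda>i. T closure_of S i) ` I)" using S(1)[of i] by auto
  qed
  then have "\<exists>C\<in>(\<lambda>i. T closure_of S i) ` I. K \<subseteq> C"
    using fin Kirr by (intro irreducible_in_finite_Union) auto
  then obtain i where i: "i \<in> I" "K \<subseteq> T closure_of S i" by blast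
  have ne: "S i \<noteq> {}"
    using i Kirr by (auto simp: irreducible_in_def)
  then have "irreducible_in (subtopology T M) (T closure_of S i)"
    using irreducible_in_closure_of[OF irr] irreducible_in_subtopology[OF S(2)] i by blast
  then show ?thesis using max i ne by metis
qed

text \<open>An irreducible set that contains \<open>T closure_of U\<close> lies in \<open>C \<union> T closure_of U\<close>. It is not
  contained in \<open>C\<close>, because it contains the nonempty set \<open>U\<close>, so it lies in the closure of \<open>U\<close>.\<close>

lemma open_irreducible_imp_component:
  assumes M: "closedin T M" and U: "irreducible_in T U" "U \<subseteq> M" and C: "closedin T C" "U = M - C"
  shows "T closure_of U \<in> irreducible_components (subtopology T M)"
proof -
  have cM: "T closure_of U \<subseteq> M"
    using M U by (simp add: closure_of_minimal)
  have sub: "U \<subseteq> T closure_of U"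
    using U by (simp add: irreducible_in_def closure_of_subset)
  have "S' = T closure_of U" if S': "irreducible_in (subtopology T M) S'" "T closure_of U \<subseteq> S'" for S'
  proof -
    have S'M: "S' \<subseteq> M" using S' by (simp add: irreducible_in_def)
    then have "irreducible_in T S'" using S' irreducible_in_subtopology by blast
    moreover have "S' \<subseteq> C \<union> T closure_of U"
      using S'M C sub by blast
    ultimately have "S' \<subseteq> C \<or> S' \<subseteq> T closure_of U"
      using C(1) closedin_closure_of unfolding irreducible_in_def by metis
    moreover have "\<not> S' \<subseteq> C"
      using S'(2) sub U(1) C(2) by (auto simp: irreducible_in_def)
    ultimately show ?thesis using S' by blast
  qed
  moreover have "irreducible_in (subtopology T M) (T closure_of U)"
    using irreducible_in_closure_of[OF U(1)] irreducible_in_subtopology[OF cM] by blast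
  ultimately show ?thesis by (auto simp: irreducible_components_def)
qed

section \<open>Irreducibility by polynomial curves\<close>

definition curve :: "complex poly mat \<times> complex poly mat \<Rightarrow> complex \<Rightarrow> complex mat \<times> complex mat" where
  "curve M t = (map_mat (\<lambda>p. poly p t) (fst M), map_mat (\<lambda>p. poly p t) (snd M))"

lemma polynomial_fun_along_curve:
  assumes "polynomial_fun n f" "M \<in> carrier_mat n n \<times> carrier_mat n n"
  shows "\<exists>q. \<forall>t. f (curve M t) = poly q t"
  using assms(1)
proof (induction rule: polynomial_fun.induct)
  case (const c)
  then show ?case by (intro exI[of _ "[:c:]"]) simp
next
  case (fst_entry i j)
  then show ?case using assms(2)
    by (intro exI[of _ "fst M $$ (i, j)"]) (auto simp: curve_def)
next
  case (snd_entry i j)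
  then show ?case using assms(2)
    by (intro exI[of _ "snd M $$ (i, j)"]) (auto simp: curve_def)
next
  case (add f g)
  then show ?case by (metis poly_add)
next
  case (mult f g)
  then show ?case by (metis poly_mult)
qed

text \<open>Suppose that two closed sets cover \<open>S\<close> and each of them misses a point of \<open>S\<close>. Take an equation
  of each set that is nonzero at the missed point. Along a polynomial curve through the two points
  both equations become nonzero polynomials in one variable, so at almost every parameter neither
  vanishes, and the curve is in \<open>S\<close> there: a point of \<open>S\<close> outside both sets. The curve may leave \<open>S\<close>
  at finitely many parameters, the zeros of \<open>e\<close>.\<close>

lemma irreducible_in_zariski_by_curves:
  assumes sub: "S \<subseteq> mat_pairs n" and ne: "S \<noteq> {}"
    and conn: "\<And>p q. p \<in> S \<Longrightarrow> q \<in> S \<Longrightarrow> \<exists>M e. M \<in> carrier_mat n n \<times> carrier_mat n n \<and>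
      e \<noteq> 0 \<and> curve M 0 = p \<and> curve M 1 = q \<and> (\<forall>t. poly e t \<noteq> 0 \<longrightarrow> curve M t \<in> S)"
  shows "irreducible_in (zariski n) S"
  unfolding irreducible_in_def
proof (intro conjI allI impI)
  show "S \<subseteq> topspace (zariski n)" "S \<noteq> {}"
    using sub ne by (auto simp: topspace_zariski)
  fix A B
  assume "closedin (zariski n) A" "closedin (zariski n) B" and AB: "S \<subseteq> A \<union> B"
  then obtain F G where F: "\<forall>f\<in>F. polynomial_fun n f" "A = zero_locus n F"
    and G: "\<forall>g\<in>G. polynomial_fun n g" "B = zero_locus n G"
    unfolding closedin_zariski by blast
  show "S \<subseteq> A \<or> S \<subseteq> B"
  proof (rule ccontr)
    assume "\<not> (S \<subseteq> A \<or> S \<subseteq> B)"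
    then obtain p q where pq: "p \<in> S" "p \<notin> A" "q \<in> S" "q \<notin> B" by blast
    then obtain f g where fg: "f \<in> F" "f p \<noteq> 0" "g \<in> G" "g q \<noteq> 0"
      using sub F(2) G(2) unfolding zero_locus_def by blast
    obtain M e where M: "M \<in> carrier_mat n n \<times> carrier_mat n n" "e \<noteq> 0"
        "curve M 0 = p" "curve M 1 = q" "\<And>t. poly e t \<noteq> 0 \<Longrightarrow> curve M t \<in> S"
      using conn[OF pq(1,3)] by blast
    obtain a b where a: "\<And>t. f (curve M t) = poly a t" and b: "\<And>t. g (curve M t) = poly b t"
      using polynomial_fun_along_curve F(1) G(1) fg M(1) by metis
    have "a \<noteq> 0" "b \<noteq> 0"
      using a[of 0] b[of 1] M fg by auto
    then have "a * b * e \<noteq> 0" using M(2) by simp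
    then obtain t where "poly (a * b * e) t \<noteq> 0"
      using poly_all_0_iff_0 by blast
    then have t: "poly a t \<noteq> 0" "poly b t \<noteq> 0" "poly e t \<noteq> 0" by auto
    then have "curve M t \<in> A \<union> B" using M(5) AB by blast
    then show False
      using t fg a b F(2) G(2) by (auto simp: zero_locus_def)
  qed
qed

section \<open>Closed conditions on pairs of matrices\<close>

text \<open>The entries agree with polynomial functions only on \<open>mat_pairs n\<close>: outside it, the entries of sums
  and products of matrices of other dimensions are not given by the usual formulas.\<close>

definition polynomial_map :: "nat \<Rightarrow> (complex mat \<times> complex mat \<Rightarrow> complex mat) \<Rightarrow> bool" where
  "polynomial_map n F \<longleftrightarrow> (\<forall>p\<in>mat_pairs n. F p \<in> carrier_mat n n) \<and>
     (\<forall>i<n. \<forall>j<n. \<exists>f. polynomial_fun n f \<and> (\<forall>p\<in>mat_pairs n. F p $$ (i, j) = f p))"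

lemma polynomial_fun_sum:
  assumes "\<And>k. k \<in> I \<Longrightarrow> polynomial_fun n (f k)"
  shows "polynomial_fun n (\<lambda>p. \<Sum>k\<in>I. f k p)"
  using assms
  by (induction I rule: infinite_finite_induct) (auto intro: polynomial_fun.intros)

lemma polynomial_map_const: "A \<in> carrier_mat n n \<Longrightarrow> polynomial_map n (\<lambda>p. A)"
  unfolding polynomial_map_def by (auto intro: polynomial_fun.const)

lemma polynomial_map_fst: "polynomial_map n fst"
  unfolding polynomial_map_def
proof (intro conjI allI impI ballI)
  fix i j assume "i < n" "j < n"
  then have "polynomial_fun n (\<lambda>p. fst p $$ (i, j))" by (rule polynomial_fun.fst_entry)
  then show "\<exists>f. polynomial_fun n f \<and> (\<forall>p\<in>mat_pairs n. fst p $$ (i, j) = f p)"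
    by (intro exI[of _ "\<lambda>p. fst p $$ (i, j)"]) simp
qed (auto simp: mat_pairs_def)

lemma polynomial_map_snd: "polynomial_map n snd"
  unfolding polynomial_map_def
proof (intro conjI allI impI ballI)
  fix i j assume "i < n" "j < n"
  then have "polynomial_fun n (\<lambda>p. snd p $$ (i, j))" by (rule polynomial_fun.snd_entry)
  then show "\<exists>f. polynomial_fun n f \<and> (\<forall>p\<in>mat_pairs n. snd p $$ (i, j) = f p)"
    by (intro exI[of _ "\<lambda>p. snd p $$ (i, j)"]) simp
qed (auto simp: mat_pairs_def)

lemma polynomial_map_smult:
  assumes "polynomial_fun n c" "polynomial_map n F"
  shows "polynomial_map n (\<lambda>p. c p \<cdot>\<^sub>m F p)"
  unfolding polynomial_map_def
proof (intro conjI allI impI ballI)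
  fix p assume "p \<in> mat_pairs n"
  then show "c p \<cdot>\<^sub>m F p \<in> carrier_mat n n" using assms by (auto simp: polynomial_map_def)
next
  fix i j assume ij: "i < n" "j < n"
  then obtain f where f: "polynomial_fun n f" "\<forall>p\<in>mat_pairs n. F p $$ (i, j) = f p"
    using assms unfolding polynomial_map_def by blast
  have "(c p \<cdot>\<^sub>m F p) $$ (i, j) = c p * f p" if "p \<in> mat_pairs n" for p
    using that f ij assms by (auto simp: polynomial_map_def)
  then show "\<exists>f. polynomial_fun n f \<and> (\<forall>p\<in>mat_pairs n. (c p \<cdot>\<^sub>m F p) $$ (i, j) = f p)"
    using polynomial_fun.mult[OF assms(1) f(1)] by (intro exI[of _ "\<lambda>p. c p * f p"]) auto
qed

lemma polynomial_map_add:
  assumes "polynomial_map n F" "polynomial_map n G"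
  shows "polynomial_map n (\<lambda>p. F p + G p)"
  unfolding polynomial_map_def
proof (intro conjI allI impI ballI)
  fix p assume "p \<in> mat_pairs n"
  then show "F p + G p \<in> carrier_mat n n" using assms by (auto simp: polynomial_map_def)
next
  fix i j assume ij: "i < n" "j < n"
  then obtain f where f: "polynomial_fun n f" "\<forall>p\<in>mat_pairs n. F p $$ (i, j) = f p"
    using assms(1) unfolding polynomial_map_def by blast
  obtain g where g: "polynomial_fun n g" "\<forall>p\<in>mat_pairs n. G p $$ (i, j) = g p"
    using assms(2) ij unfolding polynomial_map_def by blast
  have "(F p + G p) $$ (i, j) = f p + g p" if "p \<in> mat_pairs n" for p
    using that f g ij assms by (auto simp: polynomial_map_def)
  then show "\<exists>f. polynomial_fun n f \<and> (\<forall>p\<in>mat_pairs n. (F p + G p) $$ (i, j) = f p)"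
    using polynomial_fun.add[OF f(1) g(1)] by (intro exI[of _ "\<lambda>p. f p + g p"]) auto
qed

lemma polynomial_map_minus:
  assumes F: "polynomial_map n F" and G: "polynomial_map n G"
  shows "polynomial_map n (\<lambda>p. F p - G p)"
proof -
  have "polynomial_map n (\<lambda>p. F p + (- 1) \<cdot>\<^sub>m G p)"
    by (intro polynomial_map_add polynomial_map_smult F G polynomial_fun.const)
  moreover have "F p + (- 1) \<cdot>\<^sub>m G p = F p - G p" if "p \<in> mat_pairs n" for p
    using that F G by (intro eq_matI) (auto simp: polynomial_map_def)
  ultimately show ?thesis by (auto simp: polynomial_map_def)
qed

lemma polynomial_map_mult:
  assumes "polynomial_map n F" "polynomial_map n G"
  shows "polynomial_map n (\<lambda>p. F p * G p)"
  unfolding polynomial_map_def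
proof (intro conjI allI impI ballI)
  fix p assume "p \<in> mat_pairs n"
  then show "F p * G p \<in> carrier_mat n n"
    using assms unfolding polynomial_map_def by (meson mult_carrier_mat)
next
  fix i j assume ij: "i < n" "j < n"
  have "\<forall>k<n. \<exists>f. polynomial_fun n f \<and> (\<forall>p\<in>mat_pairs n. F p $$ (i, k) = f p)"
    using assms(1) ij unfolding polynomial_map_def by blast
  then obtain f where f: "\<And>k. k < n \<Longrightarrow> polynomial_fun n (f k)"
      "\<And>k p. k < n \<Longrightarrow> p \<in> mat_pairs n \<Longrightarrow> F p $$ (i, k) = f k p" by metis
  have "\<forall>k<n. \<exists>g. polynomial_fun n g \<and> (\<forall>p\<in>mat_pairs n. G p $$ (k, j) = g p)"
    using assms(2) ij unfolding polynomial_map_def by blast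
  then obtain g where g: "\<And>k. k < n \<Longrightarrow> polynomial_fun n (g k)"
      "\<And>k p. k < n \<Longrightarrow> p \<in> mat_pairs n \<Longrightarrow> G p $$ (k, j) = g k p" by metis
  have "(F p * G p) $$ (i, j) = (\<Sum>k\<in>{0..<n}. f k p * g k p)" if p: "p \<in> mat_pairs n" for p
  proof -
    have "F p \<in> carrier_mat n n" "G p \<in> carrier_mat n n"
      using p assms by (auto simp: polynomial_map_def)
    then show ?thesis
      using ij p by (simp add: scalar_prod_def f g)
  qed
  moreover have "polynomial_fun n (\<lambda>p. \<Sum>k\<in>{0..<n}. f k p * g k p)"
    by (rule polynomial_fun_sum) (auto intro!: polynomial_fun.mult f g)
  ultimately show "\<exists>f. polynomial_fun n f \<and> (\<forall>p\<in>mat_pairs n. (F p * G p) $$ (i, j) = f p)"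
    by auto
qed

lemma polynomial_map_pow:
  assumes "polynomial_map n F"
  shows "polynomial_map n (\<lambda>p. F p ^\<^sub>m k)"
proof (induction k)
  case 0
  have "polynomial_map n (\<lambda>p. 1\<^sub>m n)" by (rule polynomial_map_const) simp
  moreover have "F p ^\<^sub>m 0 = 1\<^sub>m n" if "p \<in> mat_pairs n" for p
    using that assms by (auto simp: polynomial_map_def)
  ultimately show ?case by (auto simp: polynomial_map_def)
next
  case (Suc k)
  then show ?case using polynomial_map_mult[OF _ assms] by simp
qed

lemma closedin_polynomial_map_zero:
  assumes "polynomial_map n F"
  shows "closedin (zariski n) {p \<in> mat_pairs n. F p = 0\<^sub>m n n}"
proof -
  obtain f where f: "\<And>i j. i < n \<Longrightarrow> j < n \<Longrightarrow> polynomial_fun n (f i j)"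
      "\<And>i j p. i < n \<Longrightarrow> j < n \<Longrightarrow> p \<in> mat_pairs n \<Longrightarrow> F p $$ (i, j) = f i j p"
    using assms unfolding polynomial_map_def by metis
  let ?F = "{f i j | i j. i < n \<and> j < n}"
  have "F p = 0\<^sub>m n n \<longleftrightarrow> (\<forall>g\<in>?F. g p = 0)" if p: "p \<in> mat_pairs n" for p
  proof -
    have "F p \<in> carrier_mat n n" using p assms by (auto simp: polynomial_map_def)
    then have "F p = 0\<^sub>m n n \<longleftrightarrow> (\<forall>i<n. \<forall>j<n. F p $$ (i, j) = 0)"
      by (auto simp: mat_eq_iff)
    also have "\<dots> \<longleftrightarrow> (\<forall>i<n. \<forall>j<n. f i j p = 0)"
      using f(2) p by simp
    also have "\<dots> \<longleftrightarrow> (\<forall>g\<in>?F. g p = 0)"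
      by fast
    finally show ?thesis .
  qed
  then have "{p \<in> mat_pairs n. F p = 0\<^sub>m n n} = zero_locus n ?F"
    unfolding zero_locus_def by (intro Collect_cong conj_cong) simp_all
  moreover have "\<forall>g\<in>?F. polynomial_fun n g"
    using f(1) by auto
  ultimately show ?thesis
    unfolding closedin_zariski by (intro exI[of _ ?F] conjI)
qed

lemma closedin_mod_R: "closedin (zariski n) (mod_R n)"
proof -
  have "mod_R n = {p \<in> mat_pairs n. fst p * snd p - snd p * fst p - snd p * snd p = 0\<^sub>m n n}"
    (is "_ = ?Z")
  proof (intro Set.set_eqI)
    fix p :: "complex mat \<times> complex mat"
    obtain X Y where p: "p = (X, Y)" by force
    have "X * Y - Y * X = Y * Y \<longleftrightarrow> X * Y - Y * X - Y * Y = 0\<^sub>m n n"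
      if "X \<in> carrier_mat n n" "Y \<in> carrier_mat n n"
      using that by (auto simp: mat_eq_iff)
    then show "p \<in> mod_R n \<longleftrightarrow> p \<in> ?Z"
      by (auto simp: mod_R_def mat_pairs_def p)
  qed
  moreover have "closedin (zariski n) ?Z"
    by (intro closedin_polynomial_map_zero polynomial_map_minus polynomial_map_mult
        polynomial_map_fst polynomial_map_snd)
  ultimately show ?thesis by simp
qed

section \<open>The families with a fixed nilpotent normal form\<close>

lemma conjugate_mult:
  fixes g h A B :: "complex mat"
  assumes "g \<in> carrier_mat n n" "h \<in> carrier_mat n n" "A \<in> carrier_mat n n" "B \<in> carrier_mat n n"
    and hg: "h * g = s \<cdot>\<^sub>m 1\<^sub>m n"
  shows "(g * A * h) * (g * B * h) = s \<cdot>\<^sub>m (g * (A * B) * h)"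
proof -
  have "(g * A * h) * (g * B * h) = g * (A * ((h * g) * (B * h)))"
    using assms(1-4) by (simp add: assoc_mult_mat[of _ n n _ n _ n])
  also have "(h * g) * (B * h) = s \<cdot>\<^sub>m (B * h)"
    unfolding hg using assms(1-4) by (subst mult_smult_assoc_mat[of _ n n _ n]) auto
  also have "g * (A * (s \<cdot>\<^sub>m (B * h))) = s \<cdot>\<^sub>m (g * (A * B) * h)"
    using assms(1-4)
    by (simp add: mult_smult_distrib[of _ n n _ n] assoc_mult_mat[of _ n n _ n _ n])
  finally show ?thesis .
qed

text \<open>All pairs that are simultaneously conjugate, up to a nonzero scalar, to \<open>(X, J)\<close> for some
  solution \<open>X\<close> of the relation. The inverse of \<open>g\<close> is replaced by a matrix \<open>h\<close> that inverts \<open>g\<close> up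
  to the scalar \<open>s\<close>, such as a multiple of the adjugate: with it no denominators occur, and the
  family contains polynomial curves. The scalar does not lead out of \<open>mod_R n\<close> because the relation
  is homogeneous of degree two.\<close>

definition conj_family :: "nat \<Rightarrow> complex mat \<Rightarrow> (complex mat \<times> complex mat) set" where
  "conj_family n J = {(g * X * h, g * J * h) | g h X s.
     g \<in> carrier_mat n n \<and> h \<in> carrier_mat n n \<and> X \<in> carrier_mat n n \<and>
     s \<noteq> 0 \<and> g * h = s \<cdot>\<^sub>m 1\<^sub>m n \<and> h * g = s \<cdot>\<^sub>m 1\<^sub>m n \<and> X * J - J * X = J * J}"

lemma conj_familyI:
  assumes "g \<in> carrier_mat n n" "h \<in> carrier_mat n n" "X \<in> carrier_mat n n"
    "s \<noteq> 0" "g * h = s \<cdot>\<^sub>m 1\<^sub>m n" "h * g = s \<cdot>\<^sub>m 1\<^sub>m n" "X * J - J * X = J * J"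
  shows "(g * X * h, g * J * h) \<in> conj_family n J"
  unfolding conj_family_def using assms by blast

lemma conj_family_subset_mod_R:
  assumes J: "J \<in> carrier_mat n n"
  shows "conj_family n J \<subseteq> mod_R n"
proof
  fix p assume "p \<in> conj_family n J"
  then obtain g h X s where p: "p = (g * X * h, g * J * h)"
    and C: "g \<in> carrier_mat n n" "h \<in> carrier_mat n n" "X \<in> carrier_mat n n"
    and s: "h * g = s \<cdot>\<^sub>m 1\<^sub>m n" and X: "X * J - J * X = J * J"
    unfolding conj_family_def by blast
  have XJ: "X * J \<in> carrier_mat n n" "J * X \<in> carrier_mat n n"
    using C J by (meson mult_carrier_mat)+
  have "g * (X * J - J * X) * h = g * (X * J) * h - g * (J * X) * h"
    using C J XJ
    by (simp add: mult_minus_distrib_mat[of _ n n _ n] minus_mult_distrib_mat[of _ n n _ _ n])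
  moreover have "s \<cdot>\<^sub>m (g * (X * J) * h) - s \<cdot>\<^sub>m (g * (J * X) * h)
      = s \<cdot>\<^sub>m (g * (X * J) * h - g * (J * X) * h)"
    using C by (intro eq_matI) (auto simp: algebra_simps)
  ultimately have "(g * X * h) * (g * J * h) - (g * J * h) * (g * X * h) = (g * J * h) * (g * J * h)"
    unfolding conjugate_mult[OF C(1,2,3) J s] conjugate_mult[OF C(1,2) J C(3) s]
      conjugate_mult[OF C(1,2) J J s] X by metis
  moreover have "g * X * h \<in> carrier_mat n n" "g * J * h \<in> carrier_mat n n"
    using C J by (meson mult_carrier_mat)+
  ultimately show "p \<in> mod_R n"
    unfolding mod_R_def p by blast
qed

lemma scalar_inverse_unique:
  fixes g h k :: "complex mat"
  assumes C: "g \<in> carrier_mat n n" "h \<in> carrier_mat n n" "k \<in> carrier_mat n n"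
    and "s \<noteq> 0" "h * g = s \<cdot>\<^sub>m 1\<^sub>m n" "g * k = s \<cdot>\<^sub>m 1\<^sub>m n"
  shows "h = k"
proof -
  have "s \<cdot>\<^sub>m h = h * (g * k)"
    unfolding assms using C by (subst mult_smult_distrib[of _ n n _ n]) auto
  also have "\<dots> = (h * g) * k"
    using C by (simp add: assoc_mult_mat[of _ n n _ n _ n])
  also have "\<dots> = s \<cdot>\<^sub>m k"
    unfolding assms using C by (subst mult_smult_assoc_mat[of _ n n _ n]) auto
  finally have eq: "s \<cdot>\<^sub>m h = s \<cdot>\<^sub>m k" .
  show ?thesis
  proof (rule eq_matI)
    fix i j assume "i < dim_row k" "j < dim_col k"
    then show "h $$ (i, j) = k $$ (i, j)"
      using arg_cong[OF eq, of "\<lambda>A. A $$ (i, j)"] C \<open>s \<noteq> 0\<close> by simp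
  qed (use C in auto)
qed

lemma det_nonzero_of_scalar_inverse:
  fixes g h :: "complex mat"
  assumes "g \<in> carrier_mat n n" "h \<in> carrier_mat n n" "s \<noteq> 0" "g * h = s \<cdot>\<^sub>m 1\<^sub>m n"
  shows "det g \<noteq> 0"
proof -
  have "det g * det h = s ^ n"
    using det_mult[OF assms(1,2)] assms(4) by simp
  then show ?thesis using assms(3) by auto
qed

text \<open>Interpolate linearly between the two matrices \<open>g\<close>, between the two solutions \<open>X\<close> (the relation is
  affine in \<open>X\<close>), and take for \<open>h\<close> the adjugate of the interpolated \<open>g\<close> times a linear factor
  \<open>\<sigma>\<close>. The values of \<open>\<sigma>\<close> at 0 and 1 are chosen such that the end points come out right. The
  curve leaves the family only at the zeros of \<open>\<sigma> * det G\<close>.\<close>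

lemma conj_family_curve:
  assumes J: "J \<in> carrier_mat n n" and p: "p \<in> conj_family n J" and q: "q \<in> conj_family n J"
  shows "\<exists>M e. M \<in> carrier_mat n n \<times> carrier_mat n n \<and> e \<noteq> 0 \<and> curve M 0 = p \<and> curve M 1 = q \<and>
    (\<forall>t. poly e t \<noteq> 0 \<longrightarrow> curve M t \<in> conj_family n J)"
proof -
  let ?C = "carrier_mat n n"
  obtain g h X s where p: "p = (g * X * h, g * J * h)"
    and C: "g \<in> ?C" "h \<in> ?C" "X \<in> ?C"
    and s: "s \<noteq> 0" "g * h = s \<cdot>\<^sub>m 1\<^sub>m n" "h * g = s \<cdot>\<^sub>m 1\<^sub>m n" and X: "X * J - J * X = J * J"
    using p unfolding conj_family_def by blast
  obtain g' h' X' s' where q: "q = (g' * X' * h', g' * J * h')"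
    and C': "g' \<in> ?C" "h' \<in> ?C" "X' \<in> ?C"
    and s': "s' \<noteq> 0" "g' * h' = s' \<cdot>\<^sub>m 1\<^sub>m n" "h' * g' = s' \<cdot>\<^sub>m 1\<^sub>m n"
    and X': "X' * J - J * X' = J * J"
    using q unfolding conj_family_def by blast
  define line where
    "line A B = mat n n (\<lambda>ij. [:A $$ ij, B $$ ij - A $$ ij:])" for A B :: "complex mat"
  define a where "a = s / det g"
  define b where "b = s' / det g'"
  define \<sigma> where "\<sigma> = [:a, b - a:]"
  define G where "G = line g g'"
  define H where "H = \<sigma> \<cdot>\<^sub>m adj_mat G"
  define Jp where "Jp = map_mat (\<lambda>c. [:c:]) J"
  define M where "M = (G * line X X' * H, G * Jp * H)"
  have det: "det g \<noteq> 0" "det g' \<noteq> 0"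
    using det_nonzero_of_scalar_inverse C C' s s' by blast+
  have G: "G \<in> ?C" "adj_mat G \<in> ?C" "H \<in> ?C" "line X X' \<in> ?C" "Jp \<in> ?C"
    using J adj_mat(1)[of G n] by (auto simp: G_def line_def H_def Jp_def)
  let ?E = "\<lambda>t. map_mat (\<lambda>p. poly p t)"
  have hom: "comm_ring_hom (\<lambda>p::complex poly. poly p t)" for t
    by unfold_locales auto
  have sr: "semiring_hom (\<lambda>p::complex poly. poly p t)" for t
    by unfold_locales auto
  have Emult: "?E t (A * B) = ?E t A * ?E t B" if "A \<in> ?C" "B \<in> ?C" for A B :: "complex poly mat" and t
    using semiring_hom.mat_hom_mult[OF sr that] .
  have EC: "?E t A \<in> ?C" if "A \<in> ?C" for t and A :: "complex poly mat"
    using that by simp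
  have EJ: "?E t Jp = J" for t
    using J by (auto simp: Jp_def mat_eq_iff)
  have line01: "?E 0 (line A B) = A" "?E 1 (line A B) = B" if "A \<in> ?C" "B \<in> ?C" for A B
    using that by (auto simp: line_def mat_eq_iff)
  have GH: "?E t G * ?E t H = poly (\<sigma> * det G) t \<cdot>\<^sub>m 1\<^sub>m n"
    "?E t H * ?E t G = poly (\<sigma> * det G) t \<cdot>\<^sub>m 1\<^sub>m n" for t
  proof -
    have "G * H = (\<sigma> * det G) \<cdot>\<^sub>m 1\<^sub>m n" "H * G = (\<sigma> * det G) \<cdot>\<^sub>m 1\<^sub>m n"
      unfolding H_def using G adj_mat[OF G(1)]
      by (simp_all add: mult_smult_distrib[of _ n n _ n] mult_smult_assoc_mat[of _ n n _ n] mat_eq_iff)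
    then show "?E t G * ?E t H = poly (\<sigma> * det G) t \<cdot>\<^sub>m 1\<^sub>m n"
      "?E t H * ?E t G = poly (\<sigma> * det G) t \<cdot>\<^sub>m 1\<^sub>m n"
      unfolding Emult[OF G(1,3), symmetric] Emult[OF G(3,1), symmetric]
      by (auto simp: mat_eq_iff)
  qed
  have detE: "poly (det G) t = det (?E t G)" for t
    using comm_ring_hom.hom_det[OF hom] by metis
  have "poly (det G) 0 = det g" "poly (det G) 1 = det g'"
    unfolding detE unfolding G_def line01[OF C(1) C'(1)] by (rule refl)+
  moreover have "poly \<sigma> 0 = a" "poly \<sigma> 1 = b" by (simp_all add: \<sigma>_def)
  ultimately have e0: "poly (\<sigma> * det G) 0 = s" and e1: "poly (\<sigma> * det G) 1 = s'"
    using det by (simp_all add: a_def b_def)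
  from e0 GH(1)[of 0] have H0: "?E 0 H = h"
    using scalar_inverse_unique[OF C(1,2) EC[OF G(3)] s(1,3)] line01[OF C(1) C'(1)]
    by (simp add: G_def)
  from e1 GH(1)[of 1] have H1: "?E 1 H = h'"
    using scalar_inverse_unique[OF C'(1,2) EC[OF G(3)] s'(1,3)] line01[OF C(1) C'(1)]
    by (simp add: G_def)
  have curve: "curve M t = (?E t G * ?E t (line X X') * ?E t H, ?E t G * J * ?E t H)" for t
    unfolding curve_def M_def using G J
    by (simp add: Emult mult_carrier_mat[of _ n n _ n] EJ)
  have XE: "?E t (line X X') * J - J * ?E t (line X X') = J * J" for t
  proof -
    have *: "?E t (line X X') = (1 - t) \<cdot>\<^sub>m X + t \<cdot>\<^sub>m X'"
      using C C' by (auto simp: line_def mat_eq_iff algebra_simps)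
    have "((1 - t) \<cdot>\<^sub>m X + t \<cdot>\<^sub>m X') * J = (1 - t) \<cdot>\<^sub>m (X * J) + t \<cdot>\<^sub>m (X' * J)"
      "J * ((1 - t) \<cdot>\<^sub>m X + t \<cdot>\<^sub>m X') = (1 - t) \<cdot>\<^sub>m (J * X) + t \<cdot>\<^sub>m (J * X')"
      using C C' J
      by (simp_all add: add_mult_distrib_mat[of _ n n _ _ n] mult_add_distrib_mat[of _ n n _ n]
        mult_smult_distrib[of _ n n _ n] mult_smult_assoc_mat[of _ n n _ n])
    then have "?E t (line X X') * J - J * ?E t (line X X')
      = (1 - t) \<cdot>\<^sub>m (X * J - J * X) + t \<cdot>\<^sub>m (X' * J - J * X')"
      unfolding * using C C' J by (intro eq_matI) (auto simp: algebra_simps)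
    also have "\<dots> = J * J"
      unfolding X X' using J by (intro eq_matI) (auto simp: algebra_simps)
    finally show ?thesis .
  qed
  show ?thesis
  proof (intro exI conjI allI impI)
    show "M \<in> ?C \<times> ?C"
      unfolding M_def using G by (auto intro!: mult_carrier_mat[of _ n n _ n])
    show "\<sigma> * det G \<noteq> 0" using e1 s' by auto
    show "curve M 0 = p" "curve M 1 = q"
      unfolding curve H0 H1 p q using line01 C C' by (auto simp: G_def)
    show "curve M t \<in> conj_family n J" if "poly (\<sigma> * det G) t \<noteq> 0" for t
      unfolding curve using EC G that GH XE by (intro conj_familyI)
  qed
qed

lemma irreducible_conj_family:
  assumes "J \<in> carrier_mat n n" "conj_family n J \<noteq> {}"
  shows "irreducible_in (zariski n) (conj_family n J)"
proof (rule irreducible_in_zariski_by_curves)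
  show "conj_family n J \<subseteq> mat_pairs n"
    using conj_family_subset_mod_R[OF assms(1)] by (auto simp: mod_R_def mat_pairs_def)
qed (use assms conj_family_curve in blast)+

section \<open>Nilpotency of the second matrix\<close>

text \<open>The \<open>n\<^sup>2 + 1\<close> powers of exponent at most \<open>n\<^sup>2\<close> live in a space of dimension \<open>n\<^sup>2\<close>. Writing their entries into
  the columns of a square matrix leaves the last row zero, so this matrix is singular, and a vector
  in its kernel is a linear relation.\<close>

lemma power_relation:
  fixes A :: "complex mat"
  assumes A: "A \<in> carrier_mat n n"
  obtains S c where "S \<subseteq> {..n * n}" "S \<noteq> {}" "\<And>k. k \<in> S \<Longrightarrow> c k \<noteq> 0"
    "\<And>i j. i < n \<Longrightarrow> j < n \<Longrightarrow> (\<Sum>k\<in>S. c k * (A ^\<^sub>m k) $$ (i, j)) = 0"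
proof -
  let ?N = "n * n"
  \<comment> \<open>The row index encodes the position \<open>(i, j)\<close> as \<open>i * n + j\<close>.\<close>
  define M where "M = mat (Suc ?N) (Suc ?N)
    (\<lambda>(r, k). if r < ?N then (A ^\<^sub>m k) $$ (r div n, r mod n) else 0)"
  have M: "M \<in> carrier_mat (Suc ?N) (Suc ?N)" by (simp add: M_def)
  have "transpose_mat M *\<^sub>v unit_vec (Suc ?N) ?N = 0\<^sub>v (Suc ?N)"
    by (intro eq_vecI) (auto simp: M_def)
  moreover have "unit_vec (Suc ?N) ?N \<noteq> (0\<^sub>v (Suc ?N) :: complex vec)" by simp
  ultimately have "det (transpose_mat M) = 0"
    using det_0_iff_vec_prod_zero[of "transpose_mat M" "Suc ?N"] M unit_vec_carrier by (metis transpose_carrier_mat)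
  then have "det M = 0" using det_transpose[OF M] by simp
  then obtain v where v: "v \<in> carrier_vec (Suc ?N)" "v \<noteq> 0\<^sub>v (Suc ?N)" "M *\<^sub>v v = 0\<^sub>v (Suc ?N)"
    using det_0_iff_vec_prod_zero[OF M] by blast
  let ?S = "{k. k \<le> ?N \<and> v $ k \<noteq> 0}"
  show thesis
  proof (rule that[of ?S "\<lambda>k. v $ k"])
    show "?S \<noteq> {}" using v(1,2) by (auto simp: vec_eq_iff less_Suc_eq_le)
    fix i j assume ij: "i < n" "j < n"
    have r: "i * n + j < ?N"
    proof -
      have "i * n + j < Suc i * n" using ij by simp
      also have "\<dots> \<le> n * n" using ij by (intro mult_le_mono1) simp
      finally show ?thesis .
    qed
    have "0 = (M *\<^sub>v v) $ (i * n + j)" using v(3) r by simp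
    also have "\<dots> = (\<Sum>k\<in>{0..<Suc ?N}. (A ^\<^sub>m k) $$ (i, j) * v $ k)"
      using M r v(1) ij by (auto simp: scalar_prod_def M_def intro!: sum.cong)
    also have "\<dots> = (\<Sum>k\<in>?S. (A ^\<^sub>m k) $$ (i, j) * v $ k)"
      by (intro sum.mono_neutral_right) auto
    finally show "(\<Sum>k\<in>?S. v $ k * (A ^\<^sub>m k) $$ (i, j)) = 0" by (simp add: mult.commute)
  qed auto
qed

lemma power_relation_mult:
  fixes A :: "nat \<Rightarrow> complex mat" and B :: "complex mat"
  assumes A: "\<And>k. A k \<in> carrier_mat n n" and B: "B \<in> carrier_mat n n"
    and rel: "\<And>i j. i < n \<Longrightarrow> j < n \<Longrightarrow> (\<Sum>k\<in>S. c k * A k $$ (i, j)) = 0"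
    and ij: "i < n" "j < n"
  shows "(\<Sum>k\<in>S. c k * (B * A k) $$ (i, j)) = 0" "(\<Sum>k\<in>S. c k * (A k * B) $$ (i, j)) = 0"
proof -
  have "(\<Sum>k\<in>S. c k * (B * A k) $$ (i, j)) = (\<Sum>k\<in>S. \<Sum>t<n. B $$ (i, t) * (c k * A k $$ (t, j)))"
    using A B ij carrier_matD[OF A]
    by (simp add: scalar_prod_def sum_distrib_left lessThan_atLeast0 mult_ac)
  also have "\<dots> = (\<Sum>t<n. B $$ (i, t) * (\<Sum>k\<in>S. c k * A k $$ (t, j)))"
    by (subst sum.swap) (simp add: sum_distrib_left)
  finally show "(\<Sum>k\<in>S. c k * (B * A k) $$ (i, j)) = 0" using rel ij by simp
  have "(\<Sum>k\<in>S. c k * (A k * B) $$ (i, j)) = (\<Sum>k\<in>S. \<Sum>t<n. B $$ (t, j) * (c k * A k $$ (i, t)))"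
    using A B ij carrier_matD[OF A]
    by (simp add: scalar_prod_def sum_distrib_left lessThan_atLeast0 mult_ac)
  also have "\<dots> = (\<Sum>t<n. B $$ (t, j) * (\<Sum>k\<in>S. c k * A k $$ (i, t)))"
    by (subst sum.swap) (simp add: sum_distrib_left)
  finally show "(\<Sum>k\<in>S. c k * (A k * B) $$ (i, j)) = 0" using rel ij by simp
qed

lemma pow_mat_Suc_left:
  fixes A :: "'a :: semiring_1 mat"
  assumes "A \<in> carrier_mat n n"
  shows "A ^\<^sub>m Suc k = A * A ^\<^sub>m k"
proof (induction k)
  case (Suc k)
  then show ?case using assms by (metis assoc_mult_mat pow_carrier_mat pow_mat.simps(2))
qed (use assms in simp)

lemma commutator_pow:
  fixes X Y :: "complex mat"
  assumes X: "X \<in> carrier_mat n n" and Y: "Y \<in> carrier_mat n n" and XY: "X * Y = Y * X + Y * Y"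
  shows "X * Y ^\<^sub>m k = Y ^\<^sub>m k * X + of_nat k \<cdot>\<^sub>m Y ^\<^sub>m Suc k"
proof (induction k)
  case 0
  show ?case using X Y by (auto simp: mat_eq_iff)
next
  case (Suc k)
  have Yk: "Y ^\<^sub>m k \<in> carrier_mat n n" using Y by simp
  have "X * Y ^\<^sub>m Suc k = (X * Y ^\<^sub>m k) * Y"
    using X Y Yk by (simp add: assoc_mult_mat[of _ n n _ n _ n])
  also have "\<dots> = Y ^\<^sub>m k * (X * Y) + of_nat k \<cdot>\<^sub>m (Y ^\<^sub>m Suc k * Y)"
    unfolding Suc using X Y Yk
    by (simp add: add_mult_distrib_mat[of _ n n _ _ n] mult_smult_assoc_mat[of _ n n _ n]
        assoc_mult_mat[of _ n n _ n _ n] mult_carrier_mat[of _ n n _ n])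
  also have "Y ^\<^sub>m k * (X * Y) = Y ^\<^sub>m Suc k * X + Y ^\<^sub>m Suc k * Y"
    unfolding XY using X Y Yk
    by (simp add: mult_add_distrib_mat[of _ n n _ n] assoc_mult_mat[of _ n n _ n _ n]
        mult_carrier_mat[of _ n n _ n])
  also have "Y ^\<^sub>m Suc k * X + Y ^\<^sub>m Suc k * Y + of_nat k \<cdot>\<^sub>m (Y ^\<^sub>m Suc k * Y)
      = Y ^\<^sub>m Suc k * X + of_nat (Suc k) \<cdot>\<^sub>m Y ^\<^sub>m Suc (Suc k)"
    using X Y Yk by (intro eq_matI) (auto simp: algebra_simps)
  finally show ?case .
qed

text \<open>Taking the commutator with \<open>X\<close> sends \<open>Y\<^sup>k\<close> to \<open>k Y\<^sup>k\<^sup>+\<^sup>1\<close>. Subtracting \<open>m\<close> times the relation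
  multiplied by \<open>Y\<close>, where \<open>m\<close> is one of its exponents, removes one term and keeps the other
  coefficients nonzero. When a single term is left, a power of \<open>Y\<close> vanishes.\<close>

lemma nilpotent_of_power_relation:
  fixes X Y :: "complex mat"
  assumes X: "X \<in> carrier_mat n n" and Y: "Y \<in> carrier_mat n n" and XY: "X * Y = Y * X + Y * Y"
    and "finite S" "S \<noteq> {}" "\<And>k. k \<in> S \<Longrightarrow> c k \<noteq> 0"
    and "\<And>i j. i < n \<Longrightarrow> j < n \<Longrightarrow> (\<Sum>k\<in>S. c k * (Y ^\<^sub>m k) $$ (i, j)) = 0"
  shows "\<exists>N. Y ^\<^sub>m N = 0\<^sub>m n n"
  using assms(4-7)
proof (induction "card S" arbitrary: S c rule: less_induct)
  case less
  obtain m where m: "m \<in> S" using less.prems by blast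
  have Yk: "Y ^\<^sub>m k \<in> carrier_mat n n" for k using Y by simp
  show ?case
  proof (cases "S = {m}")
    case True
    then have "(Y ^\<^sub>m m) $$ (i, j) = 0" if "i < n" "j < n" for i j
      using less.prems(3,4)[of m] less.prems(4)[OF that] by auto
    then have "Y ^\<^sub>m m = 0\<^sub>m n n" using Yk[of m] by (intro eq_matI) auto
    then show ?thesis by blast
  next
    case False
    \<comment> \<open>The shorter relation has the exponents \<open>Suc k\<close> for the old exponents \<open>k \<noteq> m\<close>.\<close>
    let ?c = "\<lambda>k. (of_nat (k - 1) - of_nat m) * c (k - 1)"
    have "(\<Sum>k\<in>Suc ` (S - {m}). ?c k * (Y ^\<^sub>m k) $$ (i, j)) = 0" if ij: "i < n" "j < n" for i j
    proof -
      have 1: "(\<Sum>k\<in>S. c k * (X * Y ^\<^sub>m k) $$ (i, j)) = 0" "(\<Sum>k\<in>S. c k * (Y ^\<^sub>m k * X) $$ (i, j)) = 0"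
        "(\<Sum>k\<in>S. c k * (Y ^\<^sub>m k * Y) $$ (i, j)) = 0"
        using power_relation_mult[of "\<lambda>k. Y ^\<^sub>m k" n, OF Yk _ less.prems(4) ij] X Y by auto
      have "(X * Y ^\<^sub>m k) $$ (i, j) = (Y ^\<^sub>m k * X) $$ (i, j) + of_nat k * (Y ^\<^sub>m Suc k) $$ (i, j)" for k
        unfolding commutator_pow[OF X Y XY] using X Y Yk[of k] ij by simp
      then have "(\<Sum>k\<in>S. c k * (of_nat k * (Y ^\<^sub>m Suc k) $$ (i, j)))
          = (\<Sum>k\<in>S. c k * (X * Y ^\<^sub>m k) $$ (i, j)) - (\<Sum>k\<in>S. c k * (Y ^\<^sub>m k * X) $$ (i, j))"
        by (simp add: sum_subtractf[symmetric] algebra_simps)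
      then have 2: "(\<Sum>k\<in>S. c k * (of_nat k * (Y ^\<^sub>m Suc k) $$ (i, j))) = 0" using 1 by simp
      have "(\<Sum>k\<in>Suc ` (S - {m}). ?c k * (Y ^\<^sub>m k) $$ (i, j))
          = (\<Sum>k\<in>S - {m}. (of_nat k - of_nat m) * c k * (Y ^\<^sub>m Suc k) $$ (i, j))"
        by (subst sum.reindex) auto
      also have "\<dots> = (\<Sum>k\<in>S. (of_nat k - of_nat m) * c k * (Y ^\<^sub>m Suc k) $$ (i, j))"
        using less.prems(1) m by (intro sum.mono_neutral_left) auto
      also have "\<dots> = (\<Sum>k\<in>S. c k * (of_nat k * (Y ^\<^sub>m Suc k) $$ (i, j)))
          - of_nat m * (\<Sum>k\<in>S. c k * (Y ^\<^sub>m k * Y) $$ (i, j))"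
        by (simp add: sum_distrib_left sum_subtractf[symmetric] algebra_simps)
      finally show ?thesis using 1 2 by simp
    qed
    moreover have "card (Suc ` (S - {m})) < card S"
      using less.prems(1) m card_gt_0_iff[of S] by (auto simp: card_image)
    ultimately show ?thesis
      using less.prems m False by (intro less.hyps[of "Suc ` (S - {m})" ?c]) auto
  qed
qed

lemma mem_mod_R_iff: "(X, Y) \<in> mod_R n \<longleftrightarrow>
    X \<in> carrier_mat n n \<and> Y \<in> carrier_mat n n \<and> X * Y = Y * X + Y * Y"
proof -
  have "X * Y - Y * X = Y * Y \<longleftrightarrow> X * Y = Y * X + Y * Y"
    if "X \<in> carrier_mat n n" "Y \<in> carrier_mat n n"
    using that by (auto simp: mat_eq_iff algebra_simps)
  then show ?thesis by (auto simp: mod_R_def)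
qed

lemma mod_R_nilpotent:
  assumes "(X, Y) \<in> mod_R n"
  shows "\<exists>N. Y ^\<^sub>m N = 0\<^sub>m n n"
proof -
  have XY: "X \<in> carrier_mat n n" "Y \<in> carrier_mat n n" "X * Y = Y * X + Y * Y"
    using assms by (auto simp: mem_mod_R_iff)
  obtain S c where S: "S \<subseteq> {..n * n}" "S \<noteq> {}" "\<And>k. k \<in> S \<Longrightarrow> c k \<noteq> 0"
    "\<And>i j. i < n \<Longrightarrow> j < n \<Longrightarrow> (\<Sum>k\<in>S. c k * (Y ^\<^sub>m k) $$ (i, j)) = 0"
    using power_relation[OF XY(2)] by blast
  then show ?thesis
    using nilpotent_of_power_relation[OF XY finite_subset[OF S(1)]] by blast
qed

section \<open>Jordan types of nilpotent matrices\<close>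

text \<open>Lists of Jordan blocks of eigenvalue 0 and total size \<open>n\<close>. A partition of \<open>n\<close> occurs once
  for each order of its parts.\<close>

definition nilpotent_types :: "nat \<Rightarrow> (nat \<times> complex) list set" where
  "nilpotent_types n = {P. set P \<subseteq> {1..n} \<times> {0} \<and> sum_list (map fst P) = n}"

lemma finite_nilpotent_types: "finite (nilpotent_types n)"
proof (rule finite_subset)
  have "length P \<le> sum_list (map fst P)" if "set P \<subseteq> {1..n} \<times> {0::complex}" for P
    using that by (induction P) auto
  then show "nilpotent_types n \<subseteq> {P. set P \<subseteq> {1..n} \<times> {0} \<and> length P \<le> n}"
    by (auto simp: nilpotent_types_def)
qed (simp add: finite_lists_length_le)

lemma jordan_matrix_nilpotent_types_carrier:
  "P \<in> nilpotent_types n \<Longrightarrow> jordan_matrix P \<in> carrier_mat n n"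
  using jordan_matrix_carrier[of P] by (simp add: nilpotent_types_def)

lemma nilpotent_jordan_nf:
  fixes Y :: "complex mat"
  assumes Y: "Y \<in> carrier_mat n n" and nil: "Y ^\<^sub>m N = 0\<^sub>m n n"
  shows "\<exists>P\<in>nilpotent_types n. jordan_nf Y P"
proof -
  obtain as where "char_poly Y = (\<Prod>a\<leftarrow>as. [:- a, 1:])"
    using char_poly_factorized[OF Y] by blast
  then obtain P where P: "jordan_nf Y P"
    using jordan_nf_exists[OF Y] by blast
  have "similar_mat Y (jordan_matrix P)" and pos: "0 \<notin> fst ` set P"
    using P by (auto simp: jordan_nf_def)
  then have sum: "sum_list (map fst P) = n"
    using similar_matD[of Y "jordan_matrix P"] Y jordan_matrix_dim(1)[of P] by (metis carrier_matD(1) insert_subset)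
  have "k \<in> {1..n} \<and> a = 0" if ka: "(k, a) \<in> set P" for k a
  proof
    have "k \<noteq> 0" using pos ka by force
    moreover have "k \<le> sum_list (map fst P)"
      using ka by (intro member_le_sum_list) (auto intro: rev_image_eqI)
    ultimately show "k \<in> {1..n}" using sum by simp
    have "poly (char_poly Y) a = 0"
      unfolding jordan_nf_char_poly[OF P] poly_prod_list prod_list_zero_iff
      using ka \<open>k \<noteq> 0\<close> by force
    then obtain v where v: "eigenvector Y v a"
      using eigenvalue_root_char_poly[OF Y] by (auto simp: eigenvalue_def)
    then have vn: "v \<in> carrier_vec n" "v \<noteq> 0\<^sub>v n"
      using Y by (auto simp: eigenvector_def)
    have "0\<^sub>m n n *\<^sub>v v = 0\<^sub>v n" using vn(1) by (intro eq_vecI) auto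
    then have "a ^ N \<cdot>\<^sub>v v = 0\<^sub>v n"
      using eigenvector_pow[OF Y v, of N] unfolding nil by simp
    then show "a = 0" using vn by (auto simp: vec_eq_iff)
  qed
  then show ?thesis using P sum by (intro bexI[of _ P]) (auto simp: nilpotent_types_def)
qed

lemma nilpotent_types_cases:
  assumes "P \<in> nilpotent_types n" "n \<ge> 1"
  obtains "P = [(n, 0)]" | k P' where "P = (k, 0) # P'" "0 < k" "k < n"
proof (cases P)
  case Nil
  then show thesis using assms by (simp add: nilpotent_types_def)
next
  case (Cons ka P')
  then obtain k where k: "P = (k, 0) # P'" "k \<ge> 1" "k + sum_list (map fst P') = n"
    "set P' \<subseteq> {1..n} \<times> {0}"
    using assms(1) by (cases ka) (auto simp: nilpotent_types_def)
  show thesis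
  proof (cases P')
    case Nil
    then show thesis using k that(1) by simp
  next
    case (Cons ka' P'')
    then have "sum_list (map fst P') \<ge> 1" using k(4) by auto
    then show thesis using k that(2) by simp
  qed
qed

lemma jordan_matrix_zero_shape:
  fixes P :: "(nat \<times> complex) list"
  assumes "snd ` set P \<subseteq> {0}" "i < sum_list (map fst P)" "j < sum_list (map fst P)"
    "jordan_matrix P $$ (i, j) \<noteq> 0"
  shows "j = Suc i"
  using assms
proof (induction P arbitrary: i j)
  case Nil
  then show ?case by simp
next
  case (Cons ka P)
  obtain k where ka: "ka = (k, 0)" using Cons.prems(1) by (cases ka) auto
  have "j - k = Suc (i - k)" if "\<not> i < k" "\<not> j < k" "jordan_matrix P $$ (i - k, j - k) \<noteq> 0"
    using Cons.prems(1-3) that by (intro Cons.IH) (auto simp: ka)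
  then show ?case
    using Cons.prems unfolding ka jordan_matrix_Cons by (auto split: if_splits)
qed

lemma jordan_matrix_block_break:
  assumes "i < k" "k \<le> j" "j < k + sum_list (map fst P)"
  shows "jordan_matrix ((k, a) # P) $$ (i, j) = 0"
  using assms unfolding jordan_matrix_Cons by auto

text \<open>A matrix supported on the first superdiagonal moves an index by one, and if it vanishes on the
  entries from below \<open>k\<close> to \<open>k\<close> or above, a product of its entries cannot pass this gap.\<close>

lemma pow_shift_support:
  fixes J :: "'a :: semiring_1 mat"
  assumes J: "J \<in> carrier_mat n n"
    and shape: "\<And>i j. i < n \<Longrightarrow> j < n \<Longrightarrow> J $$ (i, j) \<noteq> 0 \<Longrightarrow> j = Suc i"
    and break: "\<And>i j. i < k \<Longrightarrow> k \<le> j \<Longrightarrow> j < n \<Longrightarrow> J $$ (i, j) = 0"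
  shows "i < n \<Longrightarrow> j < n \<Longrightarrow> (J ^\<^sub>m m) $$ (i, j) \<noteq> 0 \<Longrightarrow> j = i + m \<and> \<not> (i < k \<and> k \<le> j)"
proof (induction m arbitrary: j)
  case 0
  then show ?case using J by (auto split: if_splits)
next
  case (Suc m)
  have "(J ^\<^sub>m Suc m) $$ (i, j) = (\<Sum>t\<in>{0..<n}. (J ^\<^sub>m m) $$ (i, t) * J $$ (t, j))"
    using J Suc.prems by (simp add: scalar_prod_def)
  with Suc.prems(3) obtain t where t: "t < n" "(J ^\<^sub>m m) $$ (i, t) \<noteq> 0" "J $$ (t, j) \<noteq> 0"
    by (metis (no_types, lifting) atLeastLessThan_iff mult_not_zero sum.neutral)
  then have "t = i + m" "\<not> (i < k \<and> k \<le> t)" using Suc.IH[of t] Suc.prems by auto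
  moreover have "j = Suc t" using shape t Suc.prems by blast
  moreover have "\<not> (t < k \<and> k \<le> j)" using break[of t j] t Suc.prems by blast
  ultimately show ?case by auto
qed

lemma pow_zero_of_nonfull_type:
  fixes Y :: "complex mat"
  assumes Y: "Y \<in> carrier_mat n n" and nf: "jordan_nf Y P"
    and P: "P \<in> nilpotent_types n" "P = (k, 0) # P'" "0 < k" "k < n"
  shows "Y ^\<^sub>m (n - 1) = 0\<^sub>m n n"
proof -
  let ?J = "jordan_matrix P"
  have J: "?J \<in> carrier_mat n n" by (rule jordan_matrix_nilpotent_types_carrier[OF P(1)])
  have sum: "sum_list (map fst P) = n" and snd: "snd ` set P \<subseteq> {0}"
    using P(1) by (auto simp: nilpotent_types_def)
  have "(?J ^\<^sub>m (n - 1)) $$ (i, j) = 0" if ij: "i < n" "j < n" for i j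
  proof (rule ccontr)
    assume "(?J ^\<^sub>m (n - 1)) $$ (i, j) \<noteq> 0"
    then have "j = i + (n - 1) \<and> \<not> (i < k \<and> k \<le> j)"
    proof (intro pow_shift_support[OF J _ _ ij])
      show "j = Suc i" if "i < n" "j < n" "?J $$ (i, j) \<noteq> 0" for i j
        using jordan_matrix_zero_shape[OF snd] that sum by simp
      show "?J $$ (i, j) = 0" if "i < k" "k \<le> j" "j < n" for i j
        using jordan_matrix_block_break[of i k j P' 0] that sum P(2) by simp
    qed
    then show False using ij P by auto
  qed
  then have "?J ^\<^sub>m (n - 1) = 0\<^sub>m n n" using J by (intro eq_matI) auto
  moreover obtain A B where "A \<in> carrier_mat n n" "B \<in> carrier_mat n n" "\<And>m. Y ^\<^sub>m m = A * ?J ^\<^sub>m m * B"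
    using jordan_nf_powE[OF Y nf] by metis
  ultimately show ?thesis by simp
qed

lemma full_jordan_nf_pow_nonzero:
  fixes Y :: "complex mat"
  assumes Y: "Y \<in> carrier_mat n n" and nf: "jordan_nf Y [(n, 0)]" and n: "n \<ge> 1"
  shows "Y ^\<^sub>m (n - 1) \<noteq> 0\<^sub>m n n"
proof
  assume 0: "Y ^\<^sub>m (n - 1) = 0\<^sub>m n n"
  let ?J = "jordan_block n 0 :: complex mat"
  have "jordan_matrix [(n, 0)] = ?J"
    by (simp add: jordan_matrix_def del: diag_block_mat.simps)
  then have "similar_mat ?J Y"
    using nf by (simp add: jordan_nf_def similar_mat_sym)
  then obtain A B where AB: "similar_mat_wit ?J Y A B" by (auto simp: similar_mat_def)
  then have "A \<in> carrier_mat n n" "B \<in> carrier_mat n n"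
    using similar_mat_witD2[OF jordan_block_carrier AB] by auto
  then have "?J ^\<^sub>m (n - 1) = 0\<^sub>m n n"
    using similar_mat_wit_pow_id[OF AB, of "n - 1"] 0 by simp
  then have "(?J ^\<^sub>m (n - 1)) $$ (0, n - 1) = 0" using n by simp
  then show False using n by (simp add: jordan_block_zero_pow)
qed

text \<open>This makes \<open>U_full n\<close> an open subset of \<open>mod_R n\<close>: the nilpotent matrices with a single Jordan
  block are those whose power of exponent \<open>n - 1\<close> does not vanish.\<close>

lemma U_full_eq_pow_nonzero:
  assumes "n \<ge> 1"
  shows "U_full n = mod_R n - {p \<in> mat_pairs n. snd p ^\<^sub>m (n - 1) = 0\<^sub>m n n}"
proof (intro Set.set_eqI)
  fix p :: "complex mat \<times> complex mat"
  obtain X Y where p: "p = (X, Y)" by force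
  have "jordan_nf Y [(n, 0)] \<longleftrightarrow> Y ^\<^sub>m (n - 1) \<noteq> 0\<^sub>m n n" if R: "(X, Y) \<in> mod_R n"
  proof
    have Y: "Y \<in> carrier_mat n n" using R by (simp add: mod_R_def)
    then show "jordan_nf Y [(n, 0)] \<Longrightarrow> Y ^\<^sub>m (n - 1) \<noteq> 0\<^sub>m n n"
      using full_jordan_nf_pow_nonzero assms by blast
    assume ne: "Y ^\<^sub>m (n - 1) \<noteq> 0\<^sub>m n n"
    obtain P where P: "P \<in> nilpotent_types n" "jordan_nf Y P"
      using mod_R_nilpotent[OF R] nilpotent_jordan_nf[OF Y] by blast
    from P(1) assms show "jordan_nf Y [(n, 0)]"
    proof (cases rule: nilpotent_types_cases)
      case 1
      then show ?thesis using P by simp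
    next
      case 2
      then show ?thesis using pow_zero_of_nonfull_type[OF Y P(2,1)] ne by blast
    qed
  qed
  then show "p \<in> U_full n \<longleftrightarrow> p \<in> mod_R n - {p \<in> mat_pairs n. snd p ^\<^sub>m (n - 1) = 0\<^sub>m n n}"
    by (auto simp: U_full_def p mod_R_def mat_pairs_def)
qed

text \<open>Conjugating \<open>(X, Y)\<close> by the matrices that bring \<open>Y\<close> into Jordan form gives a solution for the
  Jordan matrix, and conjugating back gives \<open>(X, Y)\<close>.\<close>

lemma mod_R_mem_conj_family:
  assumes R: "(X, Y) \<in> mod_R n" and nf: "jordan_nf Y P"
  shows "(X, Y) \<in> conj_family n (jordan_matrix P)"
proof -
  let ?J = "jordan_matrix P"
  have XY: "X \<in> carrier_mat n n" "Y \<in> carrier_mat n n" "X * Y - Y * X = Y * Y"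
    using R by (auto simp: mod_R_def)
  obtain A B where AB: "similar_mat_wit Y ?J A B"
    using nf by (auto simp: jordan_nf_def similar_mat_def)
  note w = similar_mat_witD2[OF XY(2) AB]
  have J: "?J = B * Y * A" 
    using similar_mat_witD2(3)[OF _ similar_mat_wit_sym[OF AB]] w by blast
  have X: "X = A * (B * X * A) * B"
  proof -
    have "A * (B * X * A) * B = (A * B) * X * (A * B)"
      using w(6,7) XY(1) by (simp add: assoc_mult_mat[of _ n n _ n _ n] mult_carrier_mat[of _ n n _ n])
    then show ?thesis unfolding w(1) using XY(1) by simp
  qed
  have one: "1\<^sub>m n = (1 :: complex) \<cdot>\<^sub>m 1\<^sub>m n" by (auto simp: mat_eq_iff)
  have AB1: "A * B = (1 :: complex) \<cdot>\<^sub>m 1\<^sub>m n" "B * A = (1 :: complex) \<cdot>\<^sub>m 1\<^sub>m n"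
    using w(1,2) one by simp_all
  have "(B * X * A, B * Y * A) \<in> conj_family n Y"
    by (rule conj_familyI[OF w(7,6) XY(1) one_neq_zero AB1(2,1) XY(3)])
  then have "(B * X * A, ?J) \<in> mod_R n"
    using conj_family_subset_mod_R[OF XY(2)] J by auto
  then have "B * X * A \<in> carrier_mat n n" "B * X * A * ?J - ?J * (B * X * A) = ?J * ?J"
    by (auto simp: mod_R_def)
  then have "(A * (B * X * A) * B, A * ?J * B) \<in> conj_family n ?J"
    using w(6,7) AB1 by (intro conj_familyI[OF _ _ _ one_neq_zero])
  then show ?thesis using X w(3) by metis
qed

lemma mod_R_cover: "mod_R n \<subseteq> (\<Union>P\<in>nilpotent_types n. conj_family n (jordan_matrix P))"
proof
  fix p assume p: "p \<in> mod_R n"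
  obtain X Y where XY: "p = (X, Y)" by force
  obtain P where "P \<in> nilpotent_types n" "jordan_nf Y P"
    using mod_R_nilpotent[of X Y n] nilpotent_jordan_nf[of Y n] p unfolding XY mem_mod_R_iff by blast
  then show "p \<in> (\<Union>P\<in>nilpotent_types n. conj_family n (jordan_matrix P))"
    using mod_R_mem_conj_family p XY by blast
qed

lemma conj_family_full_block:
  assumes "n \<ge> 1"
  shows "conj_family n (jordan_matrix [(n, 0)]) = U_full n"
proof
  show "U_full n \<subseteq> conj_family n (jordan_matrix [(n, 0)])"
    using mod_R_mem_conj_family by (auto simp: U_full_def)
  show "conj_family n (jordan_matrix [(n, 0)]) \<subseteq> U_full n"
  proof
    fix p assume p: "p \<in> conj_family n (jordan_matrix [(n, 0)])"
    let ?J = "jordan_matrix [(n, 0)] :: complex mat"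
    have J: "?J \<in> carrier_mat n n" using jordan_matrix_carrier[of "[(n, 0::complex)]"] by simp
    obtain g h X s where e: "p = (g * X * h, g * ?J * h)"
      and C: "g \<in> carrier_mat n n" "h \<in> carrier_mat n n" and s: "s \<noteq> 0"
      "g * h = s \<cdot>\<^sub>m 1\<^sub>m n" "h * g = s \<cdot>\<^sub>m 1\<^sub>m n"
      using p unfolding conj_family_def by blast
    have "jordan_nf ?J [(n, 0)]"
      using assms similar_mat_refl[OF J] by (simp add: jordan_nf_def)
    then have nf: "jordan_nf (s \<cdot>\<^sub>m ?J) [(n, 0)]"
      using jordan_nf_smult[of ?J "[(n, 0)]" s] s by simp
    have "similar_mat (g * ?J * h) (s \<cdot>\<^sub>m ?J)"
    proof (rule similar_matI)
      let ?h = "(1 / s) \<cdot>\<^sub>m h"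
      show "{g * ?J * h, s \<cdot>\<^sub>m ?J, g, ?h} \<subseteq> carrier_mat n n"
        using C J by (auto intro!: mult_carrier_mat[of _ n n _ n])
      have "g * ?h = (1 / s) \<cdot>\<^sub>m (g * h)" "?h * g = (1 / s) \<cdot>\<^sub>m (h * g)"
        using C by (simp_all add: mult_smult_distrib[of _ n n _ n] mult_smult_assoc_mat[of _ n n _ n])
      moreover have "(1 / s) \<cdot>\<^sub>m (s \<cdot>\<^sub>m 1\<^sub>m n) = (1\<^sub>m n :: complex mat)"
        using s(1) by (auto simp: mat_eq_iff)
      ultimately show "g * ?h = 1\<^sub>m n" "?h * g = 1\<^sub>m n"
        by (simp_all only: s(2,3))
      have "g * (s \<cdot>\<^sub>m ?J) * ?h = (1 / s) \<cdot>\<^sub>m (s \<cdot>\<^sub>m (g * ?J * h))"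
        using C J by (simp add: mult_smult_distrib[of _ n n _ n] mult_smult_assoc_mat[of _ n n _ n]
            mult_carrier_mat[of _ n n _ n])
      then show "g * ?J * h = g * (s \<cdot>\<^sub>m ?J) * ?h"
        using s(1) C J by (simp add: mat_eq_iff)
    qed
    then have "jordan_nf (g * ?J * h) [(n, 0)]"
      using nf similar_mat_trans unfolding jordan_nf_def by blast
    then show "p \<in> U_full n"
      using conj_family_subset_mod_R[OF J] p by (auto simp: U_full_def e)
  qed
qed

text \<open>Let \<open>D\<close> be the diagonal matrix of the indices. Since \<open>J\<close> is supported on the first superdiagonal,
  the commutator of \<open>D\<close> with \<open>J\<close> is \<open>- J\<close>, so \<open>X = - D * J\<close> solves the relation. The indicator of the
  indices below \<open>k\<close> is a diagonal matrix that commutes with \<open>J\<close> if \<open>J\<close> breaks at \<open>k\<close>, and may be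
  added to \<open>X\<close>.\<close>

lemma shift_solution:
  fixes J :: "complex mat"
  assumes J: "J \<in> carrier_mat n n"
    and shape: "\<And>i j. i < n \<Longrightarrow> j < n \<Longrightarrow> J $$ (i, j) \<noteq> 0 \<Longrightarrow> j = Suc i"
    and break: "\<And>i j. i < k \<Longrightarrow> k \<le> j \<Longrightarrow> j < n \<Longrightarrow> J $$ (i, j) = 0"
  defines "X \<equiv> mat n n (\<lambda>(i, j). (if i = j \<and> i < k then 1 else 0) - of_nat i * J $$ (i, j))"
  shows "X * J - J * X = J * J"
proof (rule eq_matI)
  fix i j assume "i < dim_row (J * J)" "j < dim_col (J * J)"
  then have ij: "i < n" "j < n" using J by auto
  let ?c = "\<lambda>i. if i < k then 1 else 0 :: complex"
  have X: "X $$ (a, b) = (if a = b then ?c a else 0) - of_nat a * J $$ (a, b)" if "a < n" "b < n" for a b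
    using that by (simp add: X_def)
  have "(X * J - J * X) $$ (i, j) = (\<Sum>t\<in>{0..<n}. X $$ (i, t) * J $$ (t, j) - J $$ (i, t) * X $$ (t, j))"
    using J ij by (simp add: X_def scalar_prod_def sum_subtractf)
  also have "\<dots> = (\<Sum>t\<in>{0..<n}. (if i = t then ?c i * J $$ (i, j) else 0)
      - (if t = j then J $$ (i, j) * ?c j else 0)
      + (of_nat t - of_nat i) * J $$ (i, t) * J $$ (t, j))"
    using ij by (intro sum.cong) (auto simp: X algebra_simps)
  also have "\<dots> = ?c i * J $$ (i, j) - J $$ (i, j) * ?c j
      + (\<Sum>t\<in>{0..<n}. (of_nat t - of_nat i) * J $$ (i, t) * J $$ (t, j))"
    using ij by (simp add: sum.distrib sum_subtractf)
  also have "?c i * J $$ (i, j) - J $$ (i, j) * ?c j = 0"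
  proof (cases "J $$ (i, j) = 0")
    case False
    then have "j = Suc i" "\<not> (i < k \<and> k \<le> j)" using shape[OF ij] break[of i j] ij by auto
    then have "i < k \<longleftrightarrow> j < k" by auto
    then show ?thesis by simp
  qed simp
  also have "(\<Sum>t\<in>{0..<n}. (of_nat t - of_nat i) * J $$ (i, t) * J $$ (t, j))
      = (\<Sum>t\<in>{0..<n}. J $$ (i, t) * J $$ (t, j))"
  proof (rule sum.cong)
    fix t assume "t \<in> {0..<n}"
    then have "t = Suc i" if "J $$ (i, t) \<noteq> 0" using shape[of i t] ij that by simp
    then show "(of_nat t - of_nat i) * J $$ (i, t) * J $$ (t, j) = J $$ (i, t) * J $$ (t, j)"
      by (cases "J $$ (i, t) = 0") auto
  qed simp
  also have "0 + (\<Sum>t\<in>{0..<n}. J $$ (i, t) * J $$ (t, j)) = (J * J) $$ (i, j)"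
    using J ij by (simp add: scalar_prod_def)
  finally show "(X * J - J * X) $$ (i, j) = (J * J) $$ (i, j)" .
qed (use J in \<open>auto simp: X_def\<close>)

lemma mem_conj_family_self:
  assumes "J \<in> carrier_mat n n" "X \<in> carrier_mat n n" "X * J - J * X = J * J"
  shows "(X, J) \<in> conj_family n J"
proof -
  have "(1\<^sub>m n * X * 1\<^sub>m n, 1\<^sub>m n * J * 1\<^sub>m n) \<in> conj_family n J"
    using assms by (intro conj_familyI[of _ _ _ _ 1]) (auto simp: mat_eq_iff)
  then show ?thesis using assms by simp
qed

lemma U_full_nonempty:
  assumes "n \<ge> 1"
  shows "U_full n \<noteq> {}"
proof -
  let ?J = "jordan_matrix [(n, 0)] :: complex mat"
  have J: "?J \<in> carrier_mat n n" using jordan_matrix_carrier[of "[(n, 0::complex)]"] by simp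
  have "\<exists>X\<in>carrier_mat n n. X * ?J - ?J * X = ?J * ?J"
  proof (rule bexI, rule shift_solution[OF J, of 0])
    show "j = Suc i" if "i < n" "j < n" "?J $$ (i, j) \<noteq> 0" for i j
      using jordan_matrix_zero_shape[of "[(n, 0)]"] that by simp
  qed auto
  then show ?thesis using mem_conj_family_self[OF J] conj_family_full_block[OF assms] by blast
qed

text \<open>For two or more blocks the second matrix can be kept while the first block of \<open>X\<close> is shifted by 1:
  the first basis vectors of the first and of the second block are then eigenvectors of \<open>X\<close> with
  eigenvalues 1 and 0.\<close>

lemma two_eigenvalues_of_nonfull_type:
  assumes P: "P \<in> nilpotent_types n" "P = (k, 0) # P'" "0 < k" "k < n"
  obtains X where "(X, jordan_matrix P) \<in> conj_family n (jordan_matrix P)"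
    "X \<in> carrier_mat n n" "eigenvalue X 0" "eigenvalue X 1"
proof -
  let ?J = "jordan_matrix P"
  have J: "?J \<in> carrier_mat n n" by (rule jordan_matrix_nilpotent_types_carrier[OF P(1)])
  have sum: "sum_list (map fst P) = n" and snd: "snd ` set P \<subseteq> {0}"
    using P(1) by (auto simp: nilpotent_types_def)
  have shape: "j = Suc i" if "i < n" "j < n" "?J $$ (i, j) \<noteq> 0" for i j
    using jordan_matrix_zero_shape[OF snd] that sum by simp
  have break: "?J $$ (i, j) = 0" if "i < k" "k \<le> j" "j < n" for i j
    using jordan_matrix_block_break[of i k j P' 0] that sum P(2) by simp
  define X where "X = mat n n (\<lambda>(i, j). (if i = j \<and> i < k then 1 else 0) - of_nat i * ?J $$ (i, j))"
  have X: "X \<in> carrier_mat n n" by (simp add: X_def)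
  have "X * ?J - ?J * X = ?J * ?J"
    unfolding X_def by (rule shift_solution[OF J shape break])
  then have mem: "(X, ?J) \<in> conj_family n ?J" by (rule mem_conj_family_self[OF J X])
  have col: "X *\<^sub>v unit_vec n m = col X m" if "m < n" for m
    using that X by (intro eq_vecI) auto
  have "X *\<^sub>v unit_vec n 0 = 1 \<cdot>\<^sub>v unit_vec n 0"
  proof -
    have "of_nat i * ?J $$ (i, 0) = 0" if "i < n" for i
      using shape[of i 0] that P by auto
    then show ?thesis using P by (subst col) (auto simp: X_def vec_eq_iff)
  qed
  then have 1: "eigenvalue X 1"
    using X P unfolding eigenvalue_def eigenvector_def by (intro exI[of _ "unit_vec n 0"]) auto
  have "X *\<^sub>v unit_vec n k = 0 \<cdot>\<^sub>v unit_vec n k"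
  proof -
    have "?J $$ (i, k) = 0" if "i < n" for i
      using shape[of i k] break[of i k] that P by auto
    then show ?thesis using P by (subst col) (auto simp: X_def vec_eq_iff)
  qed
  then have "eigenvalue X 0"
    using X P unfolding eigenvalue_def eigenvector_def by (intro exI[of _ "unit_vec n k"]) auto
  then show thesis using that mem X 1 by blast
qed

section \<open>Fitting idempotents\<close>

lemma mat_eq_on_vecI:
  fixes A B :: "'a :: semiring_1 mat"
  assumes "A \<in> carrier_mat n n" "B \<in> carrier_mat n n"
    and eq: "\<And>v. v \<in> carrier_vec n \<Longrightarrow> A *\<^sub>v v = B *\<^sub>v v"
  shows "A = B"
proof (rule eq_matI)
  fix i j assume "i < dim_row B" "j < dim_col B"
  then have ij: "i < n" "j < n" using assms by auto
  have "(A *\<^sub>v unit_vec n j) $ i = (B *\<^sub>v unit_vec n j) $ i" using eq by simp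
  then show "A $$ (i, j) = B $$ (i, j)" using ij assms(1,2) by simp
qed (use assms in auto)

lemma assoc_mult_mat4:
  fixes A B C D :: "'a :: semiring_0 mat"
  assumes "A \<in> carrier_mat n n" "B \<in> carrier_mat n n" "C \<in> carrier_mat n n" "D \<in> carrier_mat n n"
  shows "A * (B * C * D) = (A * B) * (C * D)"
  using assms by (simp add: assoc_mult_mat[of _ n n _ n _ n] mult_carrier_mat[of _ n n _ n])

lemma mat_commute_pow:
  fixes A B :: "'a :: semiring_1 mat"
  assumes "A \<in> carrier_mat n n" "B \<in> carrier_mat n n" "A * B = B * A"
  shows "A ^\<^sub>m k * B = B * A ^\<^sub>m k"
proof (induction k)
  case (Suc k)
  have "A ^\<^sub>m Suc k * B = A ^\<^sub>m k * (A * B)"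
    using assms(1,2) by (simp add: assoc_mult_mat[of _ n n _ n _ n])
  also have "\<dots> = (A ^\<^sub>m k * B) * A"
    unfolding assms(3) using assms(1,2) by (simp add: assoc_mult_mat[of _ n n _ n _ n])
  also have "\<dots> = B * A ^\<^sub>m Suc k"
    unfolding Suc using assms(1,2) by (simp add: assoc_mult_mat[of _ n n _ n _ n])
  finally show ?case .
qed (use assms in simp)

text \<open>Divide a linear relation among the powers of \<open>Z\<close> by the coefficient of its smallest exponent
  \<open>m\<close>. It then expresses \<open>Z\<^sup>m\<close> as \<open>Z\<^sup>m\<^sup>+\<^sup>1\<close> times a polynomial \<open>H\<close> in \<open>Z\<close>. The same holds for every
  larger exponent, such as \<open>n\<^sup>2 + 1\<close>, which does not depend on \<open>Z\<close>.\<close>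

lemma fitting_quasi_inverse:
  fixes Z :: "complex mat"
  assumes Z: "Z \<in> carrier_mat n n"
  obtains H where "H \<in> carrier_mat n n" "Z * H = H * Z"
    "Z ^\<^sub>m Suc (n * n) * (Z * H) = Z ^\<^sub>m Suc (n * n)"
proof -
  obtain S c where S: "S \<subseteq> {..n * n}" "S \<noteq> {}" "\<And>k. k \<in> S \<Longrightarrow> c k \<noteq> 0"
    and rel: "\<And>i j. i < n \<Longrightarrow> j < n \<Longrightarrow> (\<Sum>k\<in>S. c k * (Z ^\<^sub>m k) $$ (i, j)) = 0"
    using power_relation[OF Z] by blast
  have fin: "finite S" using S(1) finite_subset by blast
  define m where "m = Min S"
  have m: "m \<in> S" "\<And>k. k \<in> S \<Longrightarrow> m \<le> k" using fin S(2) by (auto simp: m_def)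
  let ?d = "\<lambda>k. - c k / c m"
  define H where "H = mat n n (\<lambda>ij. \<Sum>k\<in>S - {m}. ?d k * (Z ^\<^sub>m (k - Suc m)) $$ ij)"
  have H: "H \<in> carrier_mat n n" by (simp add: H_def)
  have Zk: "Z ^\<^sub>m k \<in> carrier_mat n n" for k using Z by simp
  have left: "(A * H) $$ (i, j) = (\<Sum>k\<in>S - {m}. ?d k * (A * Z ^\<^sub>m (k - Suc m)) $$ (i, j))"
    and right: "(H * A) $$ (i, j) = (\<Sum>k\<in>S - {m}. ?d k * (Z ^\<^sub>m (k - Suc m) * A) $$ (i, j))"
    if "A \<in> carrier_mat n n" "i < n" "j < n" for A i j
  proof -
    have "(A * H) $$ (i, j)
      = (\<Sum>t\<in>{0..<n}. \<Sum>k\<in>S - {m}. ?d k * (A $$ (i, t) * (Z ^\<^sub>m (k - Suc m)) $$ (t, j)))"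
      using that by (simp add: H_def scalar_prod_def sum_distrib_left mult_ac)
    also have "\<dots> = (\<Sum>k\<in>S - {m}. ?d k * (\<Sum>t\<in>{0..<n}. A $$ (i, t) * (Z ^\<^sub>m (k - Suc m)) $$ (t, j)))"
      by (subst sum.swap) (simp add: sum_distrib_left)
    also have "\<dots> = (\<Sum>k\<in>S - {m}. ?d k * (A * Z ^\<^sub>m (k - Suc m)) $$ (i, j))"
      using that Z by (simp add: scalar_prod_def)
    finally show "(A * H) $$ (i, j) = (\<Sum>k\<in>S - {m}. ?d k * (A * Z ^\<^sub>m (k - Suc m)) $$ (i, j))" .
    have "(H * A) $$ (i, j)
      = (\<Sum>t\<in>{0..<n}. \<Sum>k\<in>S - {m}. ?d k * ((Z ^\<^sub>m (k - Suc m)) $$ (i, t) * A $$ (t, j)))"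
      using that by (simp add: H_def scalar_prod_def sum_distrib_left sum_distrib_right mult_ac)
    also have "\<dots> = (\<Sum>k\<in>S - {m}. ?d k * (\<Sum>t\<in>{0..<n}. (Z ^\<^sub>m (k - Suc m)) $$ (i, t) * A $$ (t, j)))"
      by (subst sum.swap) (simp add: sum_distrib_left)
    also have "\<dots> = (\<Sum>k\<in>S - {m}. ?d k * (Z ^\<^sub>m (k - Suc m) * A) $$ (i, j))"
      using that Z by (simp add: scalar_prod_def)
    finally show "(H * A) $$ (i, j) = (\<Sum>k\<in>S - {m}. ?d k * (Z ^\<^sub>m (k - Suc m) * A) $$ (i, j))" .
  qed
  have ZH: "Z * H = H * Z"
  proof (rule eq_matI)
    fix i j assume "i < dim_row (H * Z)" "j < dim_col (H * Z)"
    then have ij: "i < n" "j < n" using H Z by auto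
    show "(Z * H) $$ (i, j) = (H * Z) $$ (i, j)"
      unfolding left[OF Z ij] right[OF Z ij] mat_commute_pow[OF Z Z refl] ..
  qed (use H Z in auto)
  have pow_add: "Z ^\<^sub>m a * Z ^\<^sub>m b = Z ^\<^sub>m (a + b)" for a b
  proof (induction b)
    case (Suc b)
    have "Z ^\<^sub>m a * Z ^\<^sub>m Suc b = (Z ^\<^sub>m a * Z ^\<^sub>m b) * Z"
      using Z by (simp add: assoc_mult_mat[of _ n n _ n _ n])
    then show ?case unfolding Suc by simp
  qed (use Z in simp)
  have main: "Z ^\<^sub>m Suc m * H = Z ^\<^sub>m m"
  proof (rule eq_matI)
    fix i j assume "i < dim_row (Z ^\<^sub>m m)" "j < dim_col (Z ^\<^sub>m m)"
    then have ij: "i < n" "j < n" using Zk[of m] by auto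
    have "(Z ^\<^sub>m Suc m * H) $$ (i, j) = (\<Sum>k\<in>S - {m}. ?d k * (Z ^\<^sub>m k) $$ (i, j))"
      unfolding left[OF Zk ij] pow_add
    proof (rule sum.cong)
      fix k assume "k \<in> S - {m}"
      then have "Suc m + (k - Suc m) = k" using m(2)[of k] by auto
      then show "?d k * (Z ^\<^sub>m (Suc m + (k - Suc m))) $$ (i, j) = ?d k * (Z ^\<^sub>m k) $$ (i, j)" by metis
    qed simp
    also have "\<dots> = (- 1 / c m) * (\<Sum>k\<in>S - {m}. c k * (Z ^\<^sub>m k) $$ (i, j))"
      by (simp add: sum_distrib_left sum_divide_distrib sum_negf)
    also have "(\<Sum>k\<in>S - {m}. c k * (Z ^\<^sub>m k) $$ (i, j)) = - c m * (Z ^\<^sub>m m) $$ (i, j)"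
      using rel[OF ij] sum.remove[OF fin m(1), of "\<lambda>k. c k * (Z ^\<^sub>m k) $$ (i, j)"]
      by (simp add: eq_neg_iff_add_eq_0 add.commute)
    also have "(- 1 / c m) * (- c m * (Z ^\<^sub>m m) $$ (i, j)) = (Z ^\<^sub>m m) $$ (i, j)"
      using S(3)[OF m(1)] by simp
    finally show "(Z ^\<^sub>m Suc m * H) $$ (i, j) = (Z ^\<^sub>m m) $$ (i, j)" .
  qed (use H Z in auto)
  have "m \<le> n * n" using m(1) S(1) by auto
  then obtain b where b: "Suc (n * n) = b + m" by (metis add.commute le_Suc_ex le_SucI)
  have "Z ^\<^sub>m Suc (n * n) * (Z * H) = Z ^\<^sub>m b * (Z ^\<^sub>m Suc m * H)"
    unfolding b pow_add[symmetric] using Z H Zk[of b] Zk[of m]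
    by (simp add: assoc_mult_mat[of _ n n _ n _ n] mult_carrier_mat[of _ n n _ n])
  also have "\<dots> = Z ^\<^sub>m Suc (n * n)"
    unfolding main pow_add b ..
  finally show thesis using that H ZH by blast
qed

text \<open>The projection onto the image of \<open>Z\<^sup>N\<close> along its kernel, for \<open>N = n\<^sup>2 + 1\<close>. With \<open>H\<close> as in the
  previous lemma it is \<open>Z\<^sup>N H\<^sup>N\<close>.\<close>

lemma fitting_idempotent:
  fixes Z :: "complex mat"
  assumes Z: "Z \<in> carrier_mat n n"
  obtains E K where "E \<in> carrier_mat n n" "K \<in> carrier_mat n n" "E * E = E" "E * Z = Z * E"
    "E = Z ^\<^sub>m Suc (n * n) * K" "E = K * Z ^\<^sub>m Suc (n * n)"
    "Z ^\<^sub>m Suc (n * n) * E = Z ^\<^sub>m Suc (n * n)" "E * Z ^\<^sub>m Suc (n * n) = Z ^\<^sub>m Suc (n * n)"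
proof -
  let ?N = "Suc (n * n)"
  let ?Z = "Z ^\<^sub>m ?N"
  obtain H where H: "H \<in> carrier_mat n n" "Z * H = H * Z" "?Z * (Z * H) = ?Z"
    using fitting_quasi_inverse[OF Z] by blast
  define K where "K = H ^\<^sub>m ?N"
  have C: "K \<in> carrier_mat n n" "?Z \<in> carrier_mat n n" "Z * H \<in> carrier_mat n n"
    using Z H by (auto simp: K_def)
  have ZHk: "Z ^\<^sub>m k * H = H * Z ^\<^sub>m k" for k
    by (rule mat_commute_pow[OF Z H(1,2)])
  have ZK: "Z * K = K * Z"
    using mat_commute_pow[OF H(1) Z H(2)[symmetric], of ?N] by (simp only: K_def)
  have ZZK: "?Z * K = K * ?Z"
    by (rule mat_commute_pow[OF Z C(1) ZK])
  have iter: "?Z * (Z ^\<^sub>m k * H ^\<^sub>m k) = ?Z" for k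
  proof (induction k)
    case 0
    show ?case using Z H C by simp
  next
    case (Suc k)
    have Ck: "Z ^\<^sub>m k \<in> carrier_mat n n" "H ^\<^sub>m k \<in> carrier_mat n n" using Z H by auto
    have "H ^\<^sub>m k * Z = Z * H ^\<^sub>m k" by (rule mat_commute_pow[OF H(1) Z H(2)[symmetric]])
    note comm = this
    have "Z ^\<^sub>m Suc k * H ^\<^sub>m Suc k = Z ^\<^sub>m k * (Z * H ^\<^sub>m k) * H"
      using Z H(1) Ck by (simp add: assoc_mult_mat[of _ n n _ n _ n] mult_carrier_mat[of _ n n _ n])
    also have "\<dots> = (Z ^\<^sub>m k * H ^\<^sub>m k) * (Z * H)"
      unfolding comm[symmetric] using Z H(1) Ck
      by (simp add: assoc_mult_mat[of _ n n _ n _ n] mult_carrier_mat[of _ n n _ n])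
    finally have "Z ^\<^sub>m Suc k * H ^\<^sub>m Suc k = (Z ^\<^sub>m k * H ^\<^sub>m k) * (Z * H)" .
    then have "?Z * (Z ^\<^sub>m Suc k * H ^\<^sub>m Suc k) = (?Z * (Z ^\<^sub>m k * H ^\<^sub>m k)) * (Z * H)"
      using C Ck by (metis assoc_mult_mat mult_carrier_mat)
    then show ?case unfolding Suc H(3) .
  qed
  let ?E = "?Z * K"
  have E: "?E \<in> carrier_mat n n" using C by (meson mult_carrier_mat)
  have ZE: "?Z * ?E = ?Z" using iter[of ?N] by (simp only: K_def)
  show thesis
  proof (rule that[OF E C(1) _ _ refl ZZK ZE])
    have "?E * ?E = (K * ?Z) * (?Z * K)" by (simp only: ZZK)
    also have "\<dots> = K * (?Z * ?E)" using C E by (meson assoc_mult_mat)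
    also have "\<dots> = K * ?Z" unfolding ZE ..
    also have "\<dots> = ?E" by (rule ZZK[symmetric])
    finally show "?E * ?E = ?E" .
    show comm: "?E * Z = Z * ?E"
    proof -
      have "?E * Z = ?Z * (Z * K)" unfolding ZK using C Z by (meson assoc_mult_mat)
      also have "\<dots> = (?Z * Z) * K" using C Z by (metis assoc_mult_mat)
      also have "?Z * Z = Z * ?Z" by (rule mat_commute_pow[OF Z Z refl])
      also have "\<dots> * K = Z * ?E" using C Z by (meson assoc_mult_mat)
      finally show ?thesis .
    qed
    show "?E * ?Z = ?Z"
      using mat_commute_pow[OF Z E comm[symmetric], of ?N] ZE by metis
  qed
qed

text \<open>The commutator of \<open>Z\<close> with \<open>P * Y\<^sup>k * Q\<close> is \<open>k\<close> times \<open>P * Y\<^sup>k\<^sup>+\<^sup>1 * Q\<close>. If the latter is zero,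
  then \<open>P * Y\<^sup>k * Q\<close> commutes with \<open>Z\<close> and vanishes by the last hypothesis. Starting from a vanishing
  power of \<open>Y\<close>, descend to \<open>k = 1\<close>.\<close>

lemma commuting_compression_zero:
  fixes Z Y P Q :: "complex mat"
  assumes Z: "Z \<in> carrier_mat n n" and Y: "Y \<in> carrier_mat n n" and ZY: "Z * Y = Y * Z + Y * Y"
    and nil: "Y ^\<^sub>m M = 0\<^sub>m n n"
    and P: "P \<in> carrier_mat n n" "Z * P = P * Z" and Q: "Q \<in> carrier_mat n n" "Z * Q = Q * Z"
    and van: "\<And>B. B \<in> carrier_mat n n \<Longrightarrow> Z * (P * B * Q) = (P * B * Q) * Z \<Longrightarrow> P * B * Q = 0\<^sub>m n n"
  shows "P * Y * Q = 0\<^sub>m n n"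
proof -
  have "P * Y ^\<^sub>m Suc 0 * Q = 0\<^sub>m n n"
  proof (rule inc_induct[of "Suc 0" "Suc M"])
    show "P * Y ^\<^sub>m Suc M * Q = 0\<^sub>m n n"
      using P Q Y nil by simp
  next
    fix k assume IH: "P * Y ^\<^sub>m Suc k * Q = 0\<^sub>m n n"
    let ?Y = "Y ^\<^sub>m k"
    have C: "?Y \<in> carrier_mat n n" "Y ^\<^sub>m Suc k \<in> carrier_mat n n"
      using Y by auto
    note [simp] = mult_carrier_mat[of _ n n _ n] assoc_mult_mat[of _ n n _ n _ n]
    have "Z * (P * ?Y * Q) = P * (Z * ?Y) * Q"
    proof -
      have "Z * (P * ?Y * Q) = (Z * P) * (?Y * Q)" using C Z P(1) Q(1) by simp
      also have "\<dots> = P * (Z * ?Y) * Q" unfolding P(2) using C Z P(1) Q(1) by simp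
      finally show ?thesis .
    qed
    also have "\<dots> = P * (?Y * Z) * Q + of_nat k \<cdot>\<^sub>m (P * Y ^\<^sub>m Suc k * Q)"
    proof -
      have "P * (?Y * Z + of_nat k \<cdot>\<^sub>m Y ^\<^sub>m Suc k) * Q
          = P * (?Y * Z) * Q + P * (of_nat k \<cdot>\<^sub>m Y ^\<^sub>m Suc k) * Q"
        using C Z P(1) Q(1)
        by (simp add: mult_add_distrib_mat[of _ n n _ n] add_mult_distrib_mat[of _ n n _ _ n] del: pow_mat.simps)
      moreover have "P * (of_nat k \<cdot>\<^sub>m Y ^\<^sub>m Suc k) * Q = of_nat k \<cdot>\<^sub>m (P * Y ^\<^sub>m Suc k * Q)"
        using C P(1) Q(1)
        by (simp add: mult_smult_distrib[of _ n n _ n] mult_smult_assoc_mat[of _ n n _ n] del: pow_mat.simps)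
      ultimately show ?thesis unfolding commutator_pow[OF Z Y ZY] by metis
    qed
    also have "\<dots> = P * (?Y * Z) * Q"
      unfolding IH using C Z P(1) Q(1) by (intro eq_matI) auto
    also have "\<dots> = (P * ?Y) * (Z * Q)" using C Z P(1) Q(1) by simp
    also have "\<dots> = (P * ?Y * Q) * Z" unfolding Q(2) using C Z P(1) Q(1) by simp
    finally show "P * ?Y * Q = 0\<^sub>m n n" using van C(1) by blast
  qed simp
  then show ?thesis using Y by simp
qed

lemma idempotent_commute_of_compressions:
  fixes E Y :: "complex mat"
  assumes E: "E \<in> carrier_mat n n" and Y: "Y \<in> carrier_mat n n"
    and "(1\<^sub>m n - E) * Y * E = 0\<^sub>m n n" "E * Y * (1\<^sub>m n - E) = 0\<^sub>m n n"
  shows "E * Y = Y * E"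
proof -
  have C: "E * Y \<in> carrier_mat n n" "Y * E \<in> carrier_mat n n" "E * Y * E \<in> carrier_mat n n"
    using E Y by (meson mult_carrier_mat)+
  have "(1\<^sub>m n - E) * Y * E = Y * E - E * Y * E"
    using E Y by (simp add: minus_mult_distrib_mat[of _ n n _ _ n] mult_carrier_mat[of _ n n _ n])
  moreover have "E * Y * (1\<^sub>m n - E) = E * Y - E * Y * E"
    using E Y C(1) by (simp add: mult_minus_distrib_mat[of _ n n _ n])
  ultimately have "Y * E - E * Y * E = E * Y - E * Y * E" using assms(3,4) by simp
  show ?thesis
  proof (rule eq_matI)
    fix i j assume "i < dim_row (Y * E)" "j < dim_col (Y * E)"
    then show "(E * Y) $$ (i, j) = (Y * E) $$ (i, j)"
      using arg_cong[OF \<open>Y * E - E * Y * E = E * Y - E * Y * E\<close>, of "\<lambda>A. A $$ (i, j)"] E Y C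
      by (simp del: index_mult_mat(1) assoc_mult_mat)
  qed (use E Y in auto)
qed

text \<open>Apply the previous descent to the two off-diagonal compressions between \<open>E\<close> and \<open>1 - E\<close>. The
  power \<open>Z\<^sup>N\<close> is zero on the image of \<open>1 - E\<close> and invertible on the image of \<open>E\<close>, so a compression that
  commutes with \<open>Z\<close> must be zero.\<close>

lemma fitting_idempotent_commutes:
  fixes Z Y :: "complex mat"
  assumes Z: "Z \<in> carrier_mat n n" and Y: "Y \<in> carrier_mat n n" and ZY: "Z * Y = Y * Z + Y * Y"
    and nil: "Y ^\<^sub>m M = 0\<^sub>m n n"
    and E: "E \<in> carrier_mat n n" "K \<in> carrier_mat n n" "E * E = E" "E * Z = Z * E"
    "E = Z ^\<^sub>m N * K" "E = K * Z ^\<^sub>m N" "Z ^\<^sub>m N * E = Z ^\<^sub>m N" "E * Z ^\<^sub>m N = Z ^\<^sub>m N"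
  shows "E * Y = Y * E"
proof -
  let ?Z = "Z ^\<^sub>m N" and ?D = "1\<^sub>m n - E"
  have ZN: "?Z \<in> carrier_mat n n" using Z by simp
  have D: "?D \<in> carrier_mat n n" by (rule minus_carrier_mat[OF E(1)])
  have ZD: "Z * ?D = ?D * Z"
    using Z E(1,4) by (simp add: mult_minus_distrib_mat[of _ n n _ n] minus_mult_distrib_mat[of _ n n _ _ n])
  have DZN: "?D * ?Z = 0\<^sub>m n n" "?Z * ?D = 0\<^sub>m n n"
    using ZN E(1,7,8)
    by (simp_all add: mult_minus_distrib_mat[of _ n n _ n] minus_mult_distrib_mat[of _ n n _ _ n]
        left_mult_one_mat[OF ZN] right_mult_one_mat[OF ZN] minus_r_inv_mat[OF ZN])
  have 1: "?D * Y * E = 0\<^sub>m n n"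
  proof (rule commuting_compression_zero[OF Z Y ZY nil D ZD E(1) E(4)[symmetric]])
    fix B assume B: "B \<in> carrier_mat n n" and comm: "Z * (?D * B * E) = (?D * B * E) * Z"
    let ?B = "?D * B * E"
    have C: "?D * B \<in> carrier_mat n n" "?B \<in> carrier_mat n n" "B * E \<in> carrier_mat n n"
      using B D E(1) by (meson mult_carrier_mat)+
    have "?Z * ?B = (?Z * ?D) * (B * E)"
      by (rule assoc_mult_mat4[OF ZN D B E(1)])
    then have "?B * ?Z = 0\<^sub>m n n"
      using mat_commute_pow[OF Z C(2) comm, of N] DZN
        left_mult_zero_mat[OF C(3)] right_mult_zero_mat[OF C(1)] by metis
    moreover have "?B = (?B * ?Z) * K"
    proof -
      have "?B = ?D * B * (E * E)" by (simp only: E(3))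
      also have "\<dots> = ?B * E" by (rule assoc_mult_mat[OF C(1) E(1) E(1), symmetric])
      also have "\<dots> = ?B * (?Z * K)" by (simp only: E(5)[symmetric])
      also have "\<dots> = (?B * ?Z) * K" by (rule assoc_mult_mat[OF C(2) ZN E(2), symmetric])
      finally show ?thesis .
    qed
    ultimately show "?B = 0\<^sub>m n n" using E(2) by simp
  qed
  have 2: "E * Y * ?D = 0\<^sub>m n n"
  proof (rule commuting_compression_zero[OF Z Y ZY nil E(1) E(4)[symmetric] D ZD])
    fix B assume B: "B \<in> carrier_mat n n" and comm: "Z * (E * B * ?D) = (E * B * ?D) * Z"
    let ?B = "E * B * ?D"
    have C: "E * B \<in> carrier_mat n n" "?B \<in> carrier_mat n n" "B * ?D \<in> carrier_mat n n"
      using B D E(1) by (meson mult_carrier_mat)+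
    have "?B * ?Z = (E * B) * (?D * ?Z)"
      by (rule assoc_mult_mat[OF C(1) D ZN])
    then have "?Z * ?B = 0\<^sub>m n n"
      using mat_commute_pow[OF Z C(2) comm, of N] DZN
        left_mult_zero_mat[OF C(3)] right_mult_zero_mat[OF C(1)] by metis
    moreover have "?B = K * (?Z * ?B)"
    proof -
      have "?B = (E * E) * (B * ?D)" unfolding E(3) by (rule assoc_mult_mat[OF E(1) B D])
      also have "\<dots> = E * ?B" by (rule assoc_mult_mat4[OF E(1) E(1) B D, symmetric])
      also have "\<dots> = (K * ?Z) * ?B" by (simp only: E(6)[symmetric])
      also have "\<dots> = K * (?Z * ?B)" by (rule assoc_mult_mat[OF E(2) ZN C(2)])
      finally show ?thesis .
    qed
    ultimately show "?B = 0\<^sub>m n n" using E(2) by simp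
  qed
  show ?thesis by (rule idempotent_commute_of_compressions[OF E(1) Y 1 2])
qed

section \<open>Indecomposable modules have a single eigenvalue\<close>

lemma R_operators_carrier:
  assumes "p \<in> mat_pairs n" "A \<in> R_operators n p"
  shows "A \<in> carrier_mat n n"
  using assms(2)
  by (induction rule: R_operators.induct) (use assms(1) in \<open>auto simp: mat_pairs_def\<close>)

lemma R_operators_commute:
  assumes p: "p \<in> mat_pairs n" and A: "A \<in> R_operators n p"
    and E: "E \<in> carrier_mat n n" "E * fst p = fst p * E" "E * snd p = snd p * E"
  shows "E * A = A * E"
  using A
proof (induction rule: R_operators.induct)
  case (scalar c)
  show ?case using E(1) by (simp add: mult_smult_distrib[of _ n n _ n] mult_smult_assoc_mat[of _ n n _ n])
next
  case (add A B)
  then show ?case using E(1) R_operators_carrier[OF p add.hyps(1)] R_operators_carrier[OF p add.hyps(2)]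
    by (simp add: mult_add_distrib_mat[of _ n n _ n] add_mult_distrib_mat[of _ n n _ _ n])
next
  case (mult A B)
  have C: "A \<in> carrier_mat n n" "B \<in> carrier_mat n n" using R_operators_carrier[OF p] mult.hyps by auto
  have "E * (A * B) = (E * A) * B" by (rule assoc_mult_mat[OF E(1) C, symmetric])
  also have "\<dots> = A * (E * B)" unfolding mult.IH(1) by (rule assoc_mult_mat[OF C(1) E(1) C(2)])
  also have "\<dots> = (A * B) * E" unfolding mult.IH(2) by (rule assoc_mult_mat[OF C E(1), symmetric])
  finally show ?case .
qed (use E in auto)

text \<open>An idempotent that commutes with the action splits the module into its image and its kernel.\<close>

lemma indecomposable_idempotent:
  assumes ind: "indecomposable n p" and p: "p \<in> mat_pairs n"
    and E: "E \<in> carrier_mat n n" "E * E = E" "E * fst p = fst p * E" "E * snd p = snd p * E"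
  shows "E = 0\<^sub>m n n \<or> E = 1\<^sub>m n"
proof -
  let ?V = "{v \<in> carrier_vec n. E *\<^sub>v v = v}" and ?W = "{v \<in> carrier_vec n. E *\<^sub>v v = 0\<^sub>v n}"
  have op: "A *\<^sub>v v \<in> carrier_vec n" "E *\<^sub>v (A *\<^sub>v v) = A *\<^sub>v (E *\<^sub>v v)"
    if "A \<in> R_operators n p" "v \<in> carrier_vec n" for A v
  proof -
    have A: "A \<in> carrier_mat n n" using R_operators_carrier[OF p that(1)] .
    then show "A *\<^sub>v v \<in> carrier_vec n" using that(2) by simp
    show "E *\<^sub>v (A *\<^sub>v v) = A *\<^sub>v (E *\<^sub>v v)"
      using R_operators_commute[OF p that(1) E(1,3,4)] A E(1) that(2)
      by (metis assoc_mult_mat_vec)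
  qed
  have zero: "A *\<^sub>v 0\<^sub>v n = 0\<^sub>v n" if "A \<in> carrier_mat n n" for A :: "complex mat"
    using that by (intro eq_vecI) auto
  have V: "R_submodule n p ?V"
    unfolding R_submodule_def using op E(1) zero[OF E(1)]
    by (auto simp: mult_add_distrib_mat_vec[of _ n n])
  have W: "R_submodule n p ?W"
    unfolding R_submodule_def using op E(1) zero R_operators_carrier[OF p]
    by (auto simp: mult_add_distrib_mat_vec[of _ n n])
  have EE: "E *\<^sub>v (E *\<^sub>v v) = E *\<^sub>v v" if "v \<in> carrier_vec n" for v
    using assoc_mult_mat_vec[OF E(1) E(1) that] E(2) by simp
  have VW: "?V \<inter> ?W = {0\<^sub>v n}" using zero[OF E(1)] by auto
  have sum: "{v + w | v w. v \<in> ?V \<and> w \<in> ?W} = carrier_vec n" (is "?S = _")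
  proof
    show "carrier_vec n \<subseteq> ?S"
    proof
      fix v :: "complex vec" assume v: "v \<in> carrier_vec n"
      have "E *\<^sub>v v \<in> ?V" using EE v E(1) by simp
      moreover have "v - E *\<^sub>v v \<in> ?W"
        using EE[OF v] v E(1) by (simp add: mult_minus_distrib_mat_vec[of _ n n])
      moreover have "v = E *\<^sub>v v + (v - E *\<^sub>v v)" using v E(1) by (intro eq_vecI) auto
      ultimately show "v \<in> ?S" by blast
    qed
  qed auto
  have "?V = {0\<^sub>v n} \<or> ?W = {0\<^sub>v n}"
    using ind V W VW sum unfolding indecomposable_def by blast
  then show ?thesis
  proof
    assume V0: "?V = {0\<^sub>v n}"
    have "E = 0\<^sub>m n n"
    proof (rule mat_eq_on_vecI[OF E(1)])
      fix v :: "complex vec" assume v: "v \<in> carrier_vec n"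
      then have "E *\<^sub>v v \<in> ?V" using EE E(1) by simp
      then have "E *\<^sub>v v = 0\<^sub>v n" using V0 by blast
      moreover have "0\<^sub>m n n *\<^sub>v v = 0\<^sub>v n" using v by (intro eq_vecI) auto
      ultimately show "E *\<^sub>v v = 0\<^sub>m n n *\<^sub>v v" by simp
    qed simp
    then show ?thesis ..
  next
    assume W0: "?W = {0\<^sub>v n}"
    have "E = 1\<^sub>m n"
    proof (rule mat_eq_on_vecI[OF E(1)])
      fix v :: "complex vec" assume v: "v \<in> carrier_vec n"
      then have "v - E *\<^sub>v v \<in> ?W"
        using EE[OF v] E(1) by (simp add: mult_minus_distrib_mat_vec[of _ n n])
      then have "v - E *\<^sub>v v = 0\<^sub>v n" using W0 by blast
      then show "E *\<^sub>v v = 1\<^sub>m n *\<^sub>v v" using v E(1) by (auto simp: vec_eq_iff)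
    qed simp
    then show ?thesis ..
  qed
qed

text \<open>The pair \<open>(X - l, Y)\<close> satisfies the same relation, so the Fitting idempotent of \<open>X - l\<close> commutes
  with \<open>X\<close> and \<open>Y\<close> and is 0 or 1. It is not 1, because \<open>X - l\<close> has a kernel.\<close>

lemma indecomposable_nilpotent_shift:
  assumes ind: "indecomposable n (X, Y)" and R: "(X, Y) \<in> mod_R n"
    and l: "eigenvalue X l"
  shows "(X - l \<cdot>\<^sub>m 1\<^sub>m n) ^\<^sub>m Suc (n * n) = 0\<^sub>m n n"
proof -
  let ?N = "Suc (n * n)"
  have X: "X \<in> carrier_mat n n" and Y: "Y \<in> carrier_mat n n" and XY: "X * Y = Y * X + Y * Y"
    using R by (auto simp: mem_mod_R_iff)
  obtain M where nil: "Y ^\<^sub>m M = 0\<^sub>m n n" using mod_R_nilpotent[OF R] by blast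
  define Z where "Z = X - l \<cdot>\<^sub>m 1\<^sub>m n"
  have Z: "Z \<in> carrier_mat n n" using X by (simp add: Z_def minus_carrier_mat)
  have XZ: "X = Z + l \<cdot>\<^sub>m 1\<^sub>m n" using X by (auto simp: Z_def mat_eq_iff)
  have ZY: "Z * Y = Y * Z + Y * Y"
  proof -
    have "Z * Y = X * Y - l \<cdot>\<^sub>m Y" "Y * Z = Y * X - l \<cdot>\<^sub>m Y"
      unfolding Z_def using X Y
      by (simp_all add: mult_minus_distrib_mat[of _ n n _ n] minus_mult_distrib_mat[of _ n n _ _ n]
        mult_smult_distrib[of _ n n _ n] mult_smult_assoc_mat[of _ n n _ n])
    then show ?thesis unfolding XY using X Y by (auto simp: mat_eq_iff)
  qed
  obtain E K where E: "E \<in> carrier_mat n n" "K \<in> carrier_mat n n" "E * E = E" "E * Z = Z * E"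
    "E = Z ^\<^sub>m ?N * K" "E = K * Z ^\<^sub>m ?N" "Z ^\<^sub>m ?N * E = Z ^\<^sub>m ?N" "E * Z ^\<^sub>m ?N = Z ^\<^sub>m ?N"
    using fitting_idempotent[OF Z] by blast
  have EY: "E * Y = Y * E"
    by (rule fitting_idempotent_commutes[OF Z Y ZY nil E])
  have EX: "E * X = X * E"
    unfolding XZ using Z E(1,4)
    by (simp add: mult_add_distrib_mat[of _ n n _ n] add_mult_distrib_mat[of _ n n _ _ n]
        mult_smult_distrib[of _ n n _ n] mult_smult_assoc_mat[of _ n n _ n])
  have "E \<noteq> 1\<^sub>m n"
  proof
    assume E1: "E = 1\<^sub>m n"
    obtain v where v: "v \<in> carrier_vec n" "v \<noteq> 0\<^sub>v n" "X *\<^sub>v v = l \<cdot>\<^sub>v v"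
      using l X by (auto simp: eigenvalue_def eigenvector_def)
    have Zv: "Z *\<^sub>v v = 0\<^sub>v n"
    proof -
      have "(l \<cdot>\<^sub>m 1\<^sub>m n) *\<^sub>v v = l \<cdot>\<^sub>v v" using v(1) by (intro eq_vecI) auto
      then show ?thesis unfolding Z_def using v X by (simp add: minus_mult_distrib_mat_vec[of _ n n])
    qed
    have zero: "A *\<^sub>v 0\<^sub>v n = 0\<^sub>v n" if "A \<in> carrier_mat n n" for A :: "complex mat"
      using that by (intro eq_vecI) auto
    have Zn: "Z ^\<^sub>m (n * n) \<in> carrier_mat n n" "Z ^\<^sub>m ?N \<in> carrier_mat n n" using Z by auto
    have "Z ^\<^sub>m ?N *\<^sub>v v = Z ^\<^sub>m (n * n) *\<^sub>v (Z *\<^sub>v v)"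
      using assoc_mult_mat_vec[OF Zn(1) Z v(1)] by simp
    then have "Z ^\<^sub>m ?N *\<^sub>v v = 0\<^sub>v n" unfolding Zv zero[OF Zn(1)] .
    then have "E *\<^sub>v v = 0\<^sub>v n"
      using E(6) assoc_mult_mat_vec[OF E(2) Zn(2) v(1)] zero[OF E(2)] by metis
    then show False using v E1 by simp
  qed
  then have "E = 0\<^sub>m n n"
    using indecomposable_idempotent[OF ind _ E(1,3)] EX EY X Y by (auto simp: mat_pairs_def)
  then show ?thesis
    using E(7) Z unfolding Z_def[symmetric] by simp
qed

section \<open>Having a single eigenvalue is a closed condition\<close>

definition mat_trace :: "'a :: comm_monoid_add mat \<Rightarrow> 'a" where
  "mat_trace A = (\<Sum>i<dim_row A. A $$ (i, i))"

lemma mat_trace_commute: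
  fixes A B :: "'a :: comm_semiring_0 mat"
  assumes "A \<in> carrier_mat n n" "B \<in> carrier_mat n n"
  shows "mat_trace (A * B) = mat_trace (B * A)"
proof -
  have "mat_trace (A * B) = (\<Sum>i<n. \<Sum>j<n. A $$ (i, j) * B $$ (j, i))"
    using assms by (simp add: mat_trace_def scalar_prod_def lessThan_atLeast0)
  also have "\<dots> = (\<Sum>j<n. \<Sum>i<n. B $$ (j, i) * A $$ (i, j))"
    by (subst sum.swap) (simp add: mult.commute)
  also have "\<dots> = mat_trace (B * A)"
    using assms by (simp add: mat_trace_def scalar_prod_def lessThan_atLeast0)
  finally show ?thesis .
qed

lemma mat_trace_nilpotent:
  fixes Z :: "complex mat"
  assumes Z: "Z \<in> carrier_mat n n" and nil: "Z ^\<^sub>m N = 0\<^sub>m n n"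
  shows "mat_trace Z = 0"
proof -
  obtain P where P: "P \<in> nilpotent_types n" "jordan_nf Z P"
    using nilpotent_jordan_nf[OF Z nil] by blast
  let ?J = "jordan_matrix P"
  obtain A B where AB: "similar_mat_wit Z ?J A B"
    using P(2) by (auto simp: jordan_nf_def similar_mat_def)
  note w = similar_mat_witD2[OF Z AB]
  have "A * ?J \<in> carrier_mat n n" using w by (meson mult_carrier_mat)
  then have "mat_trace Z = mat_trace (B * (A * ?J))"
    using mat_trace_commute w(3,7) by metis
  also have "B * (A * ?J) = (B * A) * ?J"
    using w by (intro assoc_mult_mat[symmetric])
  also have "\<dots> = ?J" using w(2) left_mult_one_mat[OF w(5)] by simp
  also have "mat_trace ?J = 0"
    unfolding mat_trace_def
  proof (rule sum.neutral, rule ballI)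
    fix i assume "i \<in> {..<dim_row ?J}"
    moreover have "snd ` set P \<subseteq> {0}" using P(1) by (auto simp: nilpotent_types_def)
    ultimately show "?J $$ (i, i) = 0"
      using jordan_matrix_zero_shape[of P i i] by auto
  qed
  finally show ?thesis .
qed

text \<open>The usual traceless part of \<open>X\<close> multiplied by \<open>n\<close>. If \<open>l\<close> is the only eigenvalue of \<open>X\<close>, it is
  \<open>n (X - l)\<close>, which is nilpotent. Conversely, if it is nilpotent, then \<open>X\<close> has no other eigenvalue
  than the trace divided by \<open>n\<close>. Its entries are polynomials in those of \<open>X\<close>.\<close>

definition traceless_part :: "nat \<Rightarrow> complex mat \<Rightarrow> complex mat" where
  "traceless_part n X = of_nat n \<cdot>\<^sub>m X + (- (\<Sum>i<n. X $$ (i, i))) \<cdot>\<^sub>m 1\<^sub>m n"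

lemma closedin_traceless_part_nilpotent:
  "closedin (zariski n) {p \<in> mat_pairs n. traceless_part n (fst p) ^\<^sub>m k = 0\<^sub>m n n}"
proof (rule closedin_polynomial_map_zero)
  have "polynomial_fun n (\<lambda>p. (- 1) * (\<Sum>i<n. fst p $$ (i, i)))"
    by (intro polynomial_fun.mult polynomial_fun.const polynomial_fun_sum polynomial_fun.fst_entry) auto
  then have "polynomial_fun n (\<lambda>p. - (\<Sum>i<n. fst p $$ (i, i)))" by simp
  then show "polynomial_map n (\<lambda>p. traceless_part n (fst p) ^\<^sub>m k)"
    unfolding traceless_part_def
    by (intro polynomial_map_pow polynomial_map_add polynomial_map_smult polynomial_map_fst
        polynomial_map_const polynomial_fun.const) auto
qed

lemma eigenvalue_of_nilpotent_traceless_part: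
  assumes X: "X \<in> carrier_mat n n" and nil: "traceless_part n X ^\<^sub>m k = 0\<^sub>m n n"
    and l: "eigenvalue X l"
  shows "of_nat n * l = (\<Sum>i<n. X $$ (i, i))"
proof -
  let ?t = "\<Sum>i<n. X $$ (i, i)"
  let ?W = "traceless_part n X"
  have W: "?W \<in> carrier_mat n n" using X by (simp add: traceless_part_def)
  obtain v where v: "v \<in> carrier_vec n" "v \<noteq> 0\<^sub>v n" "X *\<^sub>v v = l \<cdot>\<^sub>v v"
    using l X by (auto simp: eigenvalue_def eigenvector_def)
  have smult: "(c \<cdot>\<^sub>m A) *\<^sub>v v = c \<cdot>\<^sub>v (A *\<^sub>v v)" if "A \<in> carrier_mat n n" for c and A :: "complex mat"
    using that v(1) by (intro eq_vecI) auto
  have "?W *\<^sub>v v = of_nat n \<cdot>\<^sub>v (l \<cdot>\<^sub>v v) + (- ?t) \<cdot>\<^sub>v v"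
    unfolding traceless_part_def using X v
    by (simp add: add_mult_distrib_mat_vec[of _ n n] smult)
  also have "\<dots> = (of_nat n * l - ?t) \<cdot>\<^sub>v v"
    using v(1) by (intro eq_vecI) (auto simp: algebra_simps)
  finally have "eigenvector ?W v (of_nat n * l - ?t)"
    using v W by (simp add: eigenvector_def)
  then have "(of_nat n * l - ?t) ^ k \<cdot>\<^sub>v v = 0\<^sub>m n n *\<^sub>v v"
    using eigenvector_pow[OF W, of v _ k] nil by simp
  moreover have "0\<^sub>m n n *\<^sub>v v = 0\<^sub>v n" using v(1) by (intro eq_vecI) auto
  ultimately have "(of_nat n * l - ?t) ^ k \<cdot>\<^sub>v v = 0\<^sub>v n" by simp
  then have "(of_nat n * l - ?t) ^ k = 0" using v(1,2) by (auto simp: vec_eq_iff)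
  then show ?thesis by simp
qed

lemma indecomposable_traceless_part:
  assumes n: "n \<ge> 1" and R: "(X, Y) \<in> mod_R n" and ind: "indecomposable n (X, Y)"
  shows "traceless_part n X ^\<^sub>m Suc (n * n) = 0\<^sub>m n n"
proof -
  let ?N = "Suc (n * n)"
  have X: "X \<in> carrier_mat n n" using R by (simp add: mod_R_def)
  obtain l where l: "eigenvalue X l"
    using spectrum_non_empty[OF X] n by (auto simp: spectrum_def)
  define Z where "Z = X - l \<cdot>\<^sub>m 1\<^sub>m n"
  have Z: "Z \<in> carrier_mat n n" by (simp add: Z_def minus_carrier_mat)
  have nil: "Z ^\<^sub>m ?N = 0\<^sub>m n n"
    unfolding Z_def by (rule indecomposable_nilpotent_shift[OF ind R l])
  have "mat_trace Z = (\<Sum>i<n. X $$ (i, i)) - of_nat n * l"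
    using X by (simp add: mat_trace_def Z_def sum_subtractf)
  then have "(\<Sum>i<n. X $$ (i, i)) = of_nat n * l"
    using mat_trace_nilpotent[OF Z nil] by simp
  then have W: "traceless_part n X = of_nat n \<cdot>\<^sub>m Z"
    unfolding traceless_part_def Z_def using X by (intro eq_matI) (auto simp: algebra_simps)
  have pow: "(of_nat n \<cdot>\<^sub>m Z) ^\<^sub>m k = of_nat n ^ k \<cdot>\<^sub>m Z ^\<^sub>m k" for k
  proof (induction k)
    case 0
    show ?case using Z by (auto simp: mat_eq_iff)
  next
    case (Suc k)
    have Zk: "Z ^\<^sub>m k \<in> carrier_mat n n" using Z by simp
    have "(of_nat n \<cdot>\<^sub>m Z) ^\<^sub>m Suc k = (of_nat n ^ k \<cdot>\<^sub>m Z ^\<^sub>m k) * (of_nat n \<cdot>\<^sub>m Z)"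
      using Suc by simp
    also have "\<dots> = of_nat n \<cdot>\<^sub>m (of_nat n ^ k \<cdot>\<^sub>m (Z ^\<^sub>m k * Z))"
      using Z Zk by (simp add: mult_smult_distrib[of _ n n _ n] mult_smult_assoc_mat[of _ n n _ n])
    also have "\<dots> = of_nat n ^ Suc k \<cdot>\<^sub>m Z ^\<^sub>m Suc k"
      using Z Zk by (intro eq_matI) auto
    finally show ?case .
  qed
  show ?thesis unfolding W pow nil by simp
qed

section \<open>Modules with a single Jordan block\<close>

lemma R_submodule_pow:
  assumes "R_submodule n p W" "w \<in> W" "snd p \<in> carrier_mat n n"
  shows "snd p ^\<^sub>m k *\<^sub>v w \<in> W"
proof (induction k)
  case 0
  have "w \<in> carrier_vec n" using assms by (auto simp: R_submodule_def)
  then show ?case using assms by simp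
next
  case (Suc k)
  have "w \<in> carrier_vec n" using assms(1,2) by (auto simp: R_submodule_def)
  then have "snd p ^\<^sub>m Suc k *\<^sub>v w = snd p *\<^sub>v (snd p ^\<^sub>m k *\<^sub>v w)"
    unfolding pow_mat_Suc_left[OF assms(3)] using assms(3) by (intro assoc_mult_mat_vec) auto
  then show ?case
    using Suc assms(1) R_operators.y[of p n] unfolding R_submodule_def by auto
qed

lemma R_submodule_meets_kernel:
  assumes W: "R_submodule n p W" "W \<noteq> {0\<^sub>v n}" and Y: "snd p \<in> carrier_mat n n"
    and nil: "snd p ^\<^sub>m N = 0\<^sub>m n n"
  obtains u where "u \<in> W" "u \<noteq> 0\<^sub>v n" "snd p *\<^sub>v u = 0\<^sub>v n"
proof -
  obtain w where w: "w \<in> W" "w \<noteq> 0\<^sub>v n" "w \<in> carrier_vec n"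
    using W unfolding R_submodule_def by blast
  have "snd p ^\<^sub>m N *\<^sub>v w = 0\<^sub>v n" unfolding nil using w(3) by (intro eq_vecI) auto
  moreover have "snd p ^\<^sub>m 0 *\<^sub>v w \<noteq> 0\<^sub>v n" using w Y by simp
  ultimately obtain k where k: "snd p ^\<^sub>m k *\<^sub>v w \<noteq> 0\<^sub>v n" "snd p ^\<^sub>m Suc k *\<^sub>v w = 0\<^sub>v n"
    using ex_least_nat_less[of "\<lambda>k. snd p ^\<^sub>m k *\<^sub>v w = 0\<^sub>v n" N] by blast
  have "snd p *\<^sub>v (snd p ^\<^sub>m k *\<^sub>v w) = 0\<^sub>v n"
    using k(2) w(3) Y unfolding pow_mat_Suc_left[OF Y]
    by (metis assoc_mult_mat_vec pow_carrier_mat)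
  then show thesis using that R_submodule_pow[OF W(1) w(1) Y] k(1) by blast
qed

text \<open>After conjugation by \<open>A\<close> and \<open>B\<close> the kernel becomes that of a Jordan block of eigenvalue 0, which
  is spanned by the first basis vector.\<close>

lemma full_jordan_block_kernel_line:
  fixes Y :: "complex mat"
  assumes Y: "Y \<in> carrier_mat n n" and nf: "jordan_nf Y [(n, 0)]"
    and u: "u \<in> carrier_vec n" "Y *\<^sub>v u = 0\<^sub>v n"
    and w: "w \<in> carrier_vec n" "Y *\<^sub>v w = 0\<^sub>v n" "w \<noteq> 0\<^sub>v n"
  shows "\<exists>c. u = c \<cdot>\<^sub>v w"
proof -
  let ?J = "jordan_block n 0 :: complex mat"
  have "jordan_matrix [(n, 0)] = ?J"
    by (simp add: jordan_matrix_def del: diag_block_mat.simps)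
  then obtain A B where AB: "similar_mat_wit Y ?J A B"
    using nf by (auto simp: jordan_nf_def similar_mat_def)
  note s = similar_mat_witD2[OF Y AB]
  have J: "?J = B * Y * A"
    using similar_mat_witD2(3)[OF s(5) similar_mat_wit_sym[OF AB]] .
  have AB_cancel: "A *\<^sub>v (B *\<^sub>v v) = v" if "v \<in> carrier_vec n" for v
    using that s by (metis assoc_mult_mat_vec one_mult_mat_vec)
  have ker: "(B *\<^sub>v v) $ i = 0"
    if v: "v \<in> carrier_vec n" "Y *\<^sub>v v = 0\<^sub>v n" and i: "0 < i" "i < n" for v i
  proof -
    have "?J *\<^sub>v (B *\<^sub>v v) = B *\<^sub>v (Y *\<^sub>v (A *\<^sub>v (B *\<^sub>v v)))"
    proof -
      have "B *\<^sub>v v \<in> carrier_vec n" "A *\<^sub>v (B *\<^sub>v v) \<in> carrier_vec n"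
        "B * Y \<in> carrier_mat n n"
        using s v Y by (auto intro: mult_carrier_mat)
      then show ?thesis unfolding J using s Y by (simp add: assoc_mult_mat_vec[of _ n n _ n])
    qed
    also have "\<dots> = 0\<^sub>v n"
      unfolding AB_cancel[OF v(1)] v(2) using s(7) by (intro eq_vecI) auto
    finally have "(?J *\<^sub>v (B *\<^sub>v v)) $ (i - 1) = 0" using i by simp
    moreover have "(?J *\<^sub>v y) $ (i - 1) = y $ i" if y: "y \<in> carrier_vec n" for y
    proof -
      have "(?J *\<^sub>v y) $ (i - 1) = (\<Sum>t\<in>{0..<n}. ?J $$ (i - 1, t) * y $ t)"
        using i y by (simp add: scalar_prod_def)
      also have "\<dots> = (\<Sum>t\<in>{0..<n}. if t = i then y $ t else 0)"
        using i by (intro sum.cong) auto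
      finally show ?thesis using i by simp
    qed
    moreover have "B *\<^sub>v v \<in> carrier_vec n" using s(7) v(1) by simp
    ultimately show ?thesis by metis
  qed
  have Bc: "B *\<^sub>v u \<in> carrier_vec n" "B *\<^sub>v w \<in> carrier_vec n" using s u w by auto
  have "(B *\<^sub>v w) $ 0 \<noteq> 0"
  proof
    assume "(B *\<^sub>v w) $ 0 = 0"
    then have "(B *\<^sub>v w) $ i = 0" if "i < n" for i
      using ker[OF w(1,2), of i] that by (cases "i = 0") (simp_all del: index_mult_mat_vec)
    then have "B *\<^sub>v w = 0\<^sub>v n"
      using s(7) by (intro eq_vecI) (simp_all del: index_mult_mat_vec)
    then have "w = A *\<^sub>v 0\<^sub>v n" using AB_cancel[OF w(1)] by simp
    then show False using w(3) s(6) by (auto simp: vec_eq_iff)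
  qed
  then have "B *\<^sub>v u = ((B *\<^sub>v u) $ 0 / (B *\<^sub>v w) $ 0) \<cdot>\<^sub>v (B *\<^sub>v w)" (is "_ = ?c \<cdot>\<^sub>v _")
  proof (intro eq_vecI)
    fix i assume "i < dim_vec (?c \<cdot>\<^sub>v (B *\<^sub>v w))"
    then have "i < n" using s by simp
    then show "(B *\<^sub>v u) $ i = (?c \<cdot>\<^sub>v (B *\<^sub>v w)) $ i"
      using ker[OF u, of i] ker[OF w(1,2), of i] \<open>(B *\<^sub>v w) $ 0 \<noteq> 0\<close> s(7)
      by (cases "i = 0") (simp_all del: index_mult_mat_vec)
  qed (use s(7) in simp)
  then have "u = ?c \<cdot>\<^sub>v w"
    using mult_mat_vec[OF s(6) Bc(2)] AB_cancel[OF u(1)] AB_cancel[OF w(1)] by metis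
  then show ?thesis by blast
qed

text \<open>Two nonzero submodules both meet the kernel of \<open>Y\<close> nontrivially, and this kernel is a line, so
  they contain it and their intersection is not zero.\<close>

lemma U_full_indecomposable:
  assumes n: "n \<ge> 1" and p: "p \<in> U_full n"
  shows "indecomposable n p"
proof -
  obtain X Y where XY: "p = (X, Y)" by force
  have R: "(X, Y) \<in> mod_R n" and nf: "jordan_nf Y [(n, 0)]"
    using p by (auto simp: U_full_def XY)
  have Y: "Y \<in> carrier_mat n n" using R by (simp add: mod_R_def)
  obtain N where nil: "Y ^\<^sub>m N = 0\<^sub>m n n" using mod_R_nilpotent[OF R] by blast
  have "V \<inter> W \<noteq> {0\<^sub>v n}"
    if V: "R_submodule n p V" "V \<noteq> {0\<^sub>v n}" and W: "R_submodule n p W" "W \<noteq> {0\<^sub>v n}" for V W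
  proof -
    obtain v where v: "v \<in> V" "v \<noteq> 0\<^sub>v n" "Y *\<^sub>v v = 0\<^sub>v n"
      using R_submodule_meets_kernel[OF V] Y nil by (auto simp: XY)
    obtain w where w: "w \<in> W" "w \<noteq> 0\<^sub>v n" "Y *\<^sub>v w = 0\<^sub>v n"
      using R_submodule_meets_kernel[OF W] Y nil by (auto simp: XY)
    have c: "v \<in> carrier_vec n" "w \<in> carrier_vec n"
      using v w V W unfolding R_submodule_def by blast+
    obtain a where a: "v = a \<cdot>\<^sub>v w"
      using full_jordan_block_kernel_line[OF Y nf c(1) v(3) c(2) w(3,2)] by blast
    have "(a \<cdot>\<^sub>m 1\<^sub>m n) *\<^sub>v w \<in> W"
      using W(1) w(1) R_operators.scalar[of a n p] unfolding R_submodule_def by blast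
    moreover have "(a \<cdot>\<^sub>m 1\<^sub>m n) *\<^sub>v w = v" unfolding a using c(2) by (intro eq_vecI) auto
    ultimately show ?thesis using v by auto
  qed
  moreover have "(unit_vec n 0 :: complex vec) \<in> carrier_vec n" "unit_vec n 0 \<noteq> (0\<^sub>v n :: complex vec)"
    using n by auto
  then have "carrier_vec n \<noteq> {0\<^sub>v n :: complex vec}" by blast
  ultimately show ?thesis unfolding indecomposable_def by blast
qed

section \<open>The component with generically indecomposable modules\<close>

theorem corollary13p3:
  fixes n :: nat
  assumes "n \<ge> 1"
  shows "K_full n \<in> irreducible_components (mod_R_topology n)
    \<and> has_open_dense_indecomposables n (K_full n)
    \<and> (\<forall>K \<in> irreducible_components (mod_R_topology n).
         has_open_dense_indecomposables n K \<longrightarrow> K = K_full n)"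
proof (intro conjI ballI impI)
  let ?T = "zariski n"
  let ?J = "\<lambda>P. jordan_matrix P :: complex mat"
  let ?C = "{p \<in> mat_pairs n. snd p ^\<^sub>m (n - 1) = 0\<^sub>m n n}"
  have C: "closedin ?T ?C"
    by (intro closedin_polynomial_map_zero polynomial_map_pow polynomial_map_snd)
  have J: "?J P \<in> carrier_mat n n" if "P \<in> nilpotent_types n" for P
    using that by (rule jordan_matrix_nilpotent_types_carrier)
  have full: "[(n, 0)] \<in> nilpotent_types n" using assms by (simp add: nilpotent_types_def)
  have UR: "U_full n \<subseteq> mod_R n" by (auto simp: U_full_def)
  have irrU: "irreducible_in ?T (U_full n)"
    using irreducible_conj_family[OF J[OF full]] U_full_nonempty[OF assms]
    unfolding conj_family_full_block[OF assms] by blast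
  show comp: "K_full n \<in> irreducible_components (mod_R_topology n)"
    unfolding K_full_def mod_R_topology_def
    by (rule open_irreducible_imp_component[OF closedin_mod_R irrU UR C U_full_eq_pow_nonzero[OF assms]])
  have KR: "K_full n \<subseteq> mod_R n"
    unfolding K_full_def by (rule closure_of_minimal[OF UR closedin_mod_R])
  have UK: "U_full n \<subseteq> K_full n"
    unfolding K_full_def using UR closedin_subset[OF closedin_mod_R] by (intro closure_of_subset) auto
  show "has_open_dense_indecomposables n (K_full n)"
    unfolding has_open_dense_indecomposables_def
  proof (intro exI[of _ "U_full n"] conjI ballI)
    have "U_full n = K_full n - ?C" using U_full_eq_pow_nonzero[OF assms] KR UK by blast
    then show "openin (subtopology ?T (K_full n)) (U_full n)"
      using openin_subtopology_diff_closed[OF _ C, of "K_full n"] KR closedin_subset[OF closedin_mod_R]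
      by (metis subset_trans)
    show "subtopology ?T (K_full n) closure_of U_full n = K_full n"
      using UK by (simp add: closure_of_subtopology Int_absorb1 flip: K_full_def)
    show "indecomposable n p" if "p \<in> U_full n" for p
      using U_full_indecomposable[OF assms that] .
  qed
  fix K assume K: "K \<in> irreducible_components (mod_R_topology n)"
    and dense: "has_open_dense_indecomposables n K"
  have "\<exists>P\<in>nilpotent_types n. conj_family n (?J P) \<noteq> {} \<and> K = ?T closure_of conj_family n (?J P)"
    by (rule irreducible_component_eq_closure[OF K[unfolded mod_R_topology_def] closedin_mod_R
          finite_nilpotent_types irreducible_conj_family[OF J] conj_family_subset_mod_R[OF J] mod_R_cover])
  then obtain P where P: "P \<in> nilpotent_types n" "K = ?T closure_of conj_family n (?J P)"
    by blast
  let ?Z = "{p \<in> mat_pairs n. traceless_part n (fst p) ^\<^sub>m Suc (n * n) = 0\<^sub>m n n}"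
  obtain U where U: "subtopology ?T K closure_of U = K" "\<And>p. p \<in> U \<Longrightarrow> indecomposable n p"
      "openin (subtopology ?T K) U"
    using dense unfolding has_open_dense_indecomposables_def by blast
  have "U \<subseteq> K" using U(3) openin_subset by (metis topspace_subtopology le_inf_iff)
  have KR': "K \<subseteq> mod_R n"
    using K by (auto simp: mod_R_topology_def irreducible_components_def irreducible_in_def)
  \<comment> \<open>The traceless part of the first matrix is nilpotent on \<open>U\<close>, hence on its closure \<open>K\<close>.\<close>
  have "U \<subseteq> ?Z"
  proof
    fix p assume p: "p \<in> U"
    obtain X Y where XY: "p = (X, Y)" by force
    have R: "(X, Y) \<in> mod_R n" using p \<open>U \<subseteq> K\<close> KR' XY by blast
    then show "p \<in> ?Z"
      using indecomposable_traceless_part[OF assms R] U(2)[OF p]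
      by (auto simp: XY mod_R_def mat_pairs_def)
  qed
  then have "?T closure_of U \<subseteq> ?Z"
    by (rule closure_of_minimal[OF _ closedin_traceless_part_nilpotent])
  then have KZ: "K \<subseteq> ?Z"
    using closure_of_subtopology_subset[of ?T K U] U(1) by blast
  \<comment> \<open>A type with several blocks is excluded by a point of its family with two eigenvalues.\<close>
  from P(1) assms have "P = [(n, 0)]"
  proof (cases rule: nilpotent_types_cases)
    case (2 k P')
    obtain X where X: "(X, ?J P) \<in> conj_family n (?J P)" "X \<in> carrier_mat n n"
      "eigenvalue X 0" "eigenvalue X 1"
      using two_eigenvalues_of_nonfull_type[OF P(1) 2] by blast
    have "conj_family n (?J P) \<subseteq> K"
      unfolding P(2) using conj_family_subset_mod_R[OF J[OF P(1)]] closedin_subset[OF closedin_mod_R]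
      by (intro closure_of_subset) blast
    then have "traceless_part n X ^\<^sub>m Suc (n * n) = 0\<^sub>m n n" using X(1) KZ by auto
    from eigenvalue_of_nilpotent_traceless_part[OF X(2) this X(3)]
      eigenvalue_of_nilpotent_traceless_part[OF X(2) this X(4)]
    have "of_nat n = (0 :: complex)" by simp
    then show ?thesis using assms by simp
  qed
  then show "K = K_full n"
    unfolding P(2) K_full_def using conj_family_full_block[OF assms] by simp
qed

end
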